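(* Let $R:\mathbb{R}^n\to\mathbb{R}\cup\{+\infty\}$ be proper, convex and lower semicontinuous, let $F:\mathbb{R}^n\to\mathbb{R}$ be convex and differentiable with $\frac1\beta$-Lipschitz continuous gradient ($\beta>0$), put $\Phi=F+R$ and assume $\mathrm{Argmin}(\Phi)\neq\emptyset$. Suppose that an FB-type method (see context) generates a sequence $(x_k)_{k\in\mathbb{N}}$ that converges to some $x^\star\in\mathrm{Argmin}(\Phi)$ such that $R$ is partly smooth at $x^\star$ relative to $\mathcal{M}_{x^\star}$, $F$ is $C^2$ in a neighbourhood of $x^\star$, and the non-degeneracy condition $$-\nabla F(x^\star)\in\mathrm{ri}\big(\partial R(x^\star)\big)$$ holds. Then there exists $K>0$ large enough such that $x_k\in\mathcal{M}_{x^\star}$ for all $k\ge K$. If moreover (i) $\mathcal{M}_{x^\star}$ is an affine subspace, then $\mathcal{M}_{x^\star}=x^\star+T_{x^\star}$ and $y_{a,k},y_{b,k}\in\mathcal{M}_{x^\star}$ for all $k>K$; (ii) $R$ is locally polyhedral around $x^\star$, then $y_{a,k},y_{b,k}\in\mathcal{M}_{x^\star}=x^\star+T_{x^\star}$ for all $k>K$, and $\nabla_{\mathcal{M}_{x^\star}}R(x_k)=\nabla_{\mathcal{M}_{x^\star}}R(x^\star)$ and $\nabla^2_{\mathcal{M}_{x^\star}}R(x_k)=0$ for all $k\ge K$.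
   Context: FB-type method: any scheme of the following form whose sequence $(x_k)$ converges. Fix $\bar a\le 1$, $\bar b\le 1$, $\underline\epsilon,\bar\epsilon>0$ with $\underline\epsilon\le 2\beta-\bar\epsilon$, $x_0\in\mathbb{R}^n$, $x_{-1}=x_0$; for each $k$ choose $a_k\in[0,\bar a]$, $b_k\in[0,\bar b]$, $\gamma_k\in[\underline\epsilon,2\beta-\bar\epsilon]$ and set $$y_{a,k}=x_k+a_k(x_k-x_{k-1}),\quad y_{b,k}=x_k+b_k(x_k-x_{k-1}),\quad x_{k+1}=\mathrm{prox}_{\gamma_kR}\big(y_{a,k}-\gamma_k\nabla F(y_{b,k})\big),$$ where $\mathrm{prox}_{\gamma R}(z)=\mathrm{argmin}_{x}\frac12\|x-z\|^2+\gamma R(x)$. For a convex set $\Omega$, $\mathrm{ri}(\Omega)$ is its relative interior and $\mathrm{par}(\Omega)=\mathbb{R}(\Omega-\Omega)$ the subspace parallel to its affine hull. $T_x:=\mathrm{par}(\partial R(x))^\perp$. Partial smoothness: $R$ is partly smooth at $x$ relative to a set $\mathcal{M}\ni x$ if $\partial R(x)\ne\emptyset$ and: (smoothness) $\mathcal{M}$ is a $C^2$-smooth embedded submanifold of $\mathbb{R}^n$ around $x$ and $R$ restricted to $\mathcal{M}$ is $C^2$ around $x$; (sharpness) the tangent space of $\mathcal{M}$ at $x$ equals $T_x$; (continuity) the set-valued map $\partial R$ is continuous at $x$ relative to $\mathcal{M}$. $R$ is locally polyhedral around $x$ if it coincides near $x$ with a polyhedral function (one whose epigraph is a convex polyhedron).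 $\nabla_{\mathcal{M}}R$ and $\nabla^2_{\mathcal{M}}R$ denote the Riemannian gradient and Hessian of $R$ along $\mathcal{M}$ (with the Riemannian structure induced from $\mathbb{R}^n$).
   Formalization: In (ii), M = x*+T is proved only in a neighbourhood of x* (with y_{a,k}, y_{b,k} in both sets), since M is constrained only around x*: for R=0, F=x²/2, x*=0, M=(-1,1) the global equality fails. If M is affine, (i) gives full equality. *)

theory Defs
  imports "HOL-Analysis.Analysis"
begin

section \<open>Extended-real-valued convex functions\<close>

definition proper :: "('a \<Rightarrow> ereal) \<Rightarrow> bool" where
  "proper f \<longleftrightarrow> (\<forall>x. f x \<noteq> -\<infinity>) \<and> (\<exists>x. f x \<noteq> \<infinity>)"

definition epi :: "('a \<Rightarrow> ereal) \<Rightarrow> ('a \<times> real) set" where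
  "epi f = {(x, r). f x \<le> ereal r}"

definition convex_fun :: "('a::real_vector \<Rightarrow> ereal) \<Rightarrow> bool" where
  "convex_fun f \<longleftrightarrow> convex (epi f)"

definition lower_semicont :: "('a::topological_space \<Rightarrow> ereal) \<Rightarrow> bool" where
  "lower_semicont f \<longleftrightarrow> (\<forall>x. f x \<le> Liminf (at x) f)"

definition Argmin :: "('a \<Rightarrow> 'b::linorder) \<Rightarrow> 'a set" where
  "Argmin f = {x. is_arg_min f (\<lambda>_. True) x}"

text \<open>For a proper \<open>f\<close> the defining inequality forces \<open>f x\<close> to be finite.\<close>

definition subdifferential :: "('a::real_inner \<Rightarrow> ereal) \<Rightarrow> 'a \<Rightarrow> 'a set" where
  "subdifferential f x = {v. \<forall>y. f y \<ge> f x + ereal (v \<bullet> (y - x))}"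

definition par :: "'a::real_vector set \<Rightarrow> 'a set" where
  "par S = {c *\<^sub>R (u - v) | c u v. u \<in> S \<and> v \<in> S}"

definition T_space :: "('a::euclidean_space \<Rightarrow> ereal) \<Rightarrow> 'a \<Rightarrow> 'a set" where
  "T_space R x = (par (subdifferential R x))\<^sup>\<bottom>"

definition locally_polyhedral :: "('a::euclidean_space \<Rightarrow> ereal) \<Rightarrow> 'a \<Rightarrow> bool" where
  "locally_polyhedral R x \<longleftrightarrow>
     (\<exists>P U. polyhedron (epi P) \<and> open U \<and> x \<in> U \<and> (\<forall>y\<in>U. R y = P y))"

section \<open>Smooth functions and submanifolds\<close>

text \<open>Intended for open sets \<open>U\<close> only.\<close>

definition C2_on :: "'a::real_normed_vector set \<Rightarrow> ('a \<Rightarrow> 'b::real_normed_vector) \<Rightarrow> bool" where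
  "C2_on U f \<longleftrightarrow>
     (\<exists>(f' :: 'a \<Rightarrow> 'a \<Rightarrow>\<^sub>L 'b) (f'' :: 'a \<Rightarrow> 'a \<Rightarrow>\<^sub>L ('a \<Rightarrow>\<^sub>L 'b)).
        (\<forall>x\<in>U. (f has_derivative blinfun_apply (f' x)) (at x)) \<and>
        (\<forall>x\<in>U. (f' has_derivative blinfun_apply (f'' x)) (at x)) \<and>
        continuous_on U f'')"

text \<open>Embedded submanifolds are described by \<open>C\<^sup>2\<close> straightening charts of the ambient space; only
  the germ of \<open>M\<close> at \<open>x\<close> is constrained.\<close>

definition C2_submanifold_around :: "'a::euclidean_space set \<Rightarrow> 'a \<Rightarrow> bool" where
  "C2_submanifold_around M x \<longleftrightarrow> x \<in> M \<and>
     (\<exists>(U :: 'a set) (V :: 'a set) \<phi> \<psi> S.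
        open U \<and> x \<in> U \<and> open V \<and> homeomorphism U V \<phi> \<psi> \<and> C2_on U \<phi> \<and> C2_on V \<psi> \<and>
        subspace S \<and> \<phi> ` (M \<inter> U) = V \<inter> S)"

text \<open>In particular \<open>R\<close> is finite on \<open>M\<close> near \<open>x\<close>.\<close>

definition C2_along_around :: "('a::euclidean_space \<Rightarrow> ereal) \<Rightarrow> 'a set \<Rightarrow> 'a \<Rightarrow> bool" where
  "C2_along_around R M x \<longleftrightarrow>
     (\<exists>U g. open U \<and> x \<in> U \<and> C2_on U g \<and> (\<forall>y \<in> M \<inter> U. R y = ereal (g y)))"

definition curve_in :: "'a::euclidean_space set \<Rightarrow> 'a \<Rightarrow> (real \<Rightarrow> 'a) \<Rightarrow> 'a \<Rightarrow> bool" where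
  "curve_in M x c h \<longleftrightarrow> c 0 = x \<and> (c has_vector_derivative h) (at 0) \<and>
     (\<exists>e>0. c ` {-e<..<e} \<subseteq> M \<and> c C1_differentiable_on {-e<..<e})"

definition tangent_space :: "'a::euclidean_space set \<Rightarrow> 'a \<Rightarrow> 'a set" where
  "tangent_space M x = {h. \<exists>c. curve_in M x c h}"

text \<open>The predicates below include the requirement that \<open>M\<close> is a manifold around \<open>x\<close> along which
  \<open>R\<close> is \<open>C\<^sup>2\<close>. The Hessian is the covariant derivative of the gradient for the Levi-Civita
  connection of the induced metric, that is, the tangential part of the derivative of the gradient
  along curves in \<open>M\<close>. Only the values of \<open>H\<close> on the tangent space are constrained.\<close>

definition has_riemannian_gradient ::
    "('a::euclidean_space \<Rightarrow> ereal) \<Rightarrow> 'a set \<Rightarrow> 'a \<Rightarrow> 'a \<Rightarrow> bool" where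
  "has_riemannian_gradient R M x g \<longleftrightarrow>
     C2_submanifold_around M x \<and> C2_along_around R M x \<and> g \<in> tangent_space M x \<and>
     (\<forall>c h. curve_in M x c h \<longrightarrow>
        ((\<lambda>t. real_of_ereal (R (c t))) has_real_derivative (g \<bullet> h)) (at 0))"

definition riemannian_gradient ::
    "('a::euclidean_space \<Rightarrow> ereal) \<Rightarrow> 'a set \<Rightarrow> 'a \<Rightarrow> 'a" where
  "riemannian_gradient R M x = (THE g. has_riemannian_gradient R M x g)"

definition has_riemannian_hessian ::
    "('a::euclidean_space \<Rightarrow> ereal) \<Rightarrow> 'a set \<Rightarrow> 'a \<Rightarrow> ('a \<Rightarrow> 'a) \<Rightarrow> bool" where
  "has_riemannian_hessian R M x H \<longleftrightarrow>
     C2_submanifold_around M x \<and> C2_along_around R M x \<and>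
     (\<forall>c h. curve_in M x c h \<longrightarrow>
        (\<exists>v. ((\<lambda>t. riemannian_gradient R M (c t)) has_vector_derivative v) (at 0) \<and>
             H h = closest_point (tangent_space M x) v))"

text \<open>Equality of germs.\<close>

definition coincide_around :: "'a::topological_space \<Rightarrow> 'a set \<Rightarrow> 'a set \<Rightarrow> bool" where
  "coincide_around x A B \<longleftrightarrow> (\<exists>U. open U \<and> x \<in> U \<and> A \<inter> U = B \<inter> U)"

section \<open>Partial smoothness\<close>

text \<open>Painleve--Kuratowski continuity relative to \<open>M\<close>: outer and inner semicontinuity.\<close>

definition set_valued_continuous_at_relative ::
    "('a::euclidean_space \<Rightarrow> 'a set) \<Rightarrow> 'a \<Rightarrow> 'a set \<Rightarrow> bool" where
  "set_valued_continuous_at_relative A x M \<longleftrightarrow>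
     (\<forall>z w v. (\<forall>k. z k \<in> M) \<and> z \<longlonglongrightarrow> x \<and> (\<forall>k. w k \<in> A (z k)) \<and> w \<longlonglongrightarrow> v \<longrightarrow> v \<in> A x) \<and>
     (\<forall>z. \<forall>v \<in> A x. (\<forall>k. z k \<in> M) \<and> z \<longlonglongrightarrow> x \<longrightarrow>
        (\<exists>w. (\<forall>\<^sub>F k in sequentially. w k \<in> A (z k)) \<and> w \<longlonglongrightarrow> v))"

definition partly_smooth :: "('a::euclidean_space \<Rightarrow> ereal) \<Rightarrow> 'a \<Rightarrow> 'a set \<Rightarrow> bool" where
  "partly_smooth R x M \<longleftrightarrow>
     x \<in> M \<and> subdifferential R x \<noteq> {} \<and>
     C2_submanifold_around M x \<and> C2_along_around R M x \<and>
     tangent_space M x = T_space R x \<and>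
     set_valued_continuous_at_relative (subdifferential R) x M"

section \<open>Forward-backward-type iterations\<close>

text \<open>The set of minimisers, which is a singleton for \<open>R\<close> proper, convex and lower semicontinuous
  and \<open>\<gamma> > 0\<close>.\<close>

definition prox :: "real \<Rightarrow> ('a::real_inner \<Rightarrow> ereal) \<Rightarrow> 'a \<Rightarrow> 'a set" where
  "prox \<gamma> R z = Argmin (\<lambda>x. ereal (1/2 * (norm (x - z))\<^sup>2) + ereal \<gamma> * R x)"

text \<open>The convention that the iterate of index \<open>-1\<close> equals \<open>x 0\<close> is built into \<open>x (k - 1)\<close> through
  truncated subtraction.\<close>

definition FB_type_iterates ::
    "('a::real_inner \<Rightarrow> 'a) \<Rightarrow> ('a \<Rightarrow> ereal) \<Rightarrow> real \<Rightarrow> (nat \<Rightarrow> real) \<Rightarrow> (nat \<Rightarrow> real) \<Rightarrow>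
     (nat \<Rightarrow> real) \<Rightarrow> (nat \<Rightarrow> 'a) \<Rightarrow> (nat \<Rightarrow> 'a) \<Rightarrow> (nat \<Rightarrow> 'a) \<Rightarrow> bool" where
  "FB_type_iterates gradF R \<beta> a b \<gamma> x ya yb \<longleftrightarrow>
     (\<exists>abar bbar elow eup.
        abar \<le> 1 \<and> bbar \<le> 1 \<and> elow > 0 \<and> eup > 0 \<and> elow \<le> 2 * \<beta> - eup \<and>
        (\<forall>k. a k \<in> {0..abar} \<and> b k \<in> {0..bbar} \<and> \<gamma> k \<in> {elow..2 * \<beta> - eup})) \<and>
     (\<forall>k. ya k = x k + a k *\<^sub>R (x k - x (k - 1))) \<and>
     (\<forall>k. yb k = x k + b k *\<^sub>R (x k - x (k - 1))) \<and>
     (\<forall>k. x (Suc k) \<in> prox (\<gamma> k) R (ya k - \<gamma> k *\<^sub>R gradF (yb k)))"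

end

theory Submission
  imports Defs
begin

text \<open>
  The optimality condition of the proximal step yields \<open>w\<^sub>k \<in> \<partial>R(x\<^sub>k)\<close> with
  \<open>w\<^sub>k \<longlonglongrightarrow> u = -\<nabla>F(x\<^sup>\<star>)\<close>. Suppose that \<open>x\<^sub>k \<notin> M\<close> infinitely often and let \<open>p\<^sub>k\<close> be a point of \<open>M\<close> nearest
  to \<open>x\<^sub>k\<close>. The unit vectors along \<open>x\<^sub>k - p\<^sub>k\<close> are normal to \<open>M\<close> at \<open>p\<^sub>k\<close>, so they accumulate at a
  unit vector \<open>l\<close> normal to \<open>M\<close> at \<open>x\<^sup>\<star>\<close>. By sharpness and nondegeneracy \<open>u + \<epsilon> l\<close> is a subgradient at
  \<open>x\<^sup>\<star>\<close> for some \<open>\<epsilon> > 0\<close>; by continuity of \<open>\<partial>R\<close> along \<open>M\<close> it is the limit of subgradients at \<open>p\<^sub>k\<close>, and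
  monotonicity of \<open>\<partial>R\<close> gives \<open>\<langle>u - (u + \<epsilon> l), l\<rangle> \<ge> 0\<close>, which is absurd.

  If \<open>R\<close> is locally polyhedral, then \<open>u\<close> remains a subgradient at the points of \<open>x\<^sup>\<star> + T\<close> near \<open>x\<^sup>\<star>\<close>, so the
  same argument puts these points into \<open>M\<close>; conversely \<open>R\<close> grows linearly in the directions
  normal to \<open>T\<close>, which forces \<open>M\<close> into \<open>x\<^sup>\<star> + T\<close>. Hence \<open>R\<close> is affine along \<open>M\<close>.
\<close>

section \<open>Subgradients of convex functions\<close>

lemma subdifferential_finite:
  assumes "proper f" "v \<in> subdifferential f x"
  obtains r where "f x = ereal r"
proof -
  obtain y where y: "f y \<noteq> \<infinity>" using assms(1) by (auto simp: proper_def)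
  have "f x \<noteq> \<infinity>"
  proof
    assume "f x = \<infinity>"
    moreover have "f y \<ge> f x + ereal (v \<bullet> (y - x))"
      using assms(2) by (simp add: subdifferential_def)
    ultimately show False using y by simp
  qed
  then show thesis using that assms(1) by (cases "f x") (auto simp: proper_def)
qed

lemma subdifferential_monotone:
  assumes "proper f" and u: "u \<in> subdifferential f x" and v: "v \<in> subdifferential f y"
  shows "(u - v) \<bullet> (x - y) \<ge> 0"
proof -
  obtain r where r: "f x = ereal r" using subdifferential_finite[OF assms(1) u] .
  obtain s where s: "f y = ereal s" using subdifferential_finite[OF assms(1) v] .
  have "f y \<ge> f x + ereal (u \<bullet> (y - x))" "f x \<ge> f y + ereal (v \<bullet> (x - y))"
    using u v by (simp_all add: subdifferential_def)
  then have "s \<ge> r + u \<bullet> (y - x)" "r \<ge> s + v \<bullet> (x - y)" using r s by simp_all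
  then show ?thesis by (simp add: inner_diff_left inner_diff_right)
qed

lemma convex_fun_le:
  assumes "convex_fun f" "f x = ereal r" "f y = ereal s" "0 \<le> t" "t \<le> 1"
  shows "f (x + t *\<^sub>R (y - x)) \<le> ereal (r + t * (s - r))"
proof -
  have "(x, r) \<in> epi f" "(y, s) \<in> epi f" using assms by (simp_all add: epi_def)
  then have "(1 - t) *\<^sub>R (x, r) + t *\<^sub>R (y, s) \<in> epi f"
    using assms unfolding convex_fun_def by (intro convexD) auto
  then show ?thesis by (simp add: epi_def algebra_simps)
qed

text \<open>A local affine minorant is a global one: \<open>y\<close> is moved along the segment
  towards \<open>x\<close> until it lies in \<open>W\<close>; convexity bounds the value there by
  the chord, and the inequality is divided by \<open>t\<close>.\<close>

lemma subdifferential_local: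
  fixes f :: "'a::real_inner \<Rightarrow> ereal"
  assumes f: "proper f" "convex_fun f" and r: "f x = ereal r"
    and W: "open W" "x \<in> W"
    and le: "\<And>y s. y \<in> W \<Longrightarrow> f y = ereal s \<Longrightarrow> r + v \<bullet> (y - x) \<le> s"
  shows "v \<in> subdifferential f x"
  unfolding subdifferential_def
proof (intro CollectI allI)
  fix y
  show "f y \<ge> f x + ereal (v \<bullet> (y - x))"
  proof (cases "f y")
    case (real s)
    have "((\<lambda>t. x + t *\<^sub>R (y - x)) \<longlongrightarrow> x + 0 *\<^sub>R (y - x)) (at_right 0)"
      by (intro tendsto_intros)
    then have "\<forall>\<^sub>F t in at_right 0. x + t *\<^sub>R (y - x) \<in> W"
      using W by (intro topological_tendstoD) auto
    moreover have "\<forall>\<^sub>F t in at_right (0::real). t \<in> {0<..<1}"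
      by (rule eventually_at_right_real) simp
    ultimately have "\<forall>\<^sub>F t in at_right 0. x + t *\<^sub>R (y - x) \<in> W \<and> t < 1 \<and> 0 < t"
      by eventually_elim auto
    then obtain t where t: "x + t *\<^sub>R (y - x) \<in> W" "t < 1" "0 < t"
      using eventually_happens'[OF trivial_limit_at_right_real] by blast
    have le1: "f (x + t *\<^sub>R (y - x)) \<le> ereal (r + t * (s - r))"
      using t by (intro convex_fun_le[OF f(2) r real]) auto
    have "f (x + t *\<^sub>R (y - x)) \<noteq> -\<infinity>" using f(1) by (auto simp: proper_def)
    with le1 obtain q where q: "f (x + t *\<^sub>R (y - x)) = ereal q"
      by (cases "f (x + t *\<^sub>R (y - x))") auto
    have "r + v \<bullet> (t *\<^sub>R (y - x)) \<le> q" using le[OF t(1) q] by simp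
    also have "q \<le> r + t * (s - r)" using le1 q by simp
    finally have "t * (v \<bullet> (y - x)) \<le> t * (s - r)" by simp
    then have "v \<bullet> (y - x) \<le> s - r" using t by simp
    then show ?thesis using real r by simp
  qed (use f(1) in \<open>auto simp: proper_def\<close>)
qed

text \<open>Fermat's rule: between \<open>p\<close> and \<open>p + t *\<^sub>R h\<close> the chord
  bounds the increment of \<open>f\<close>, and the quadratic remainder disappears after division by
  \<open>t\<close> as \<open>t\<close> tends to 0.\<close>

lemma prox_imp_subdifferential:
  fixes f :: "'a::real_inner \<Rightarrow> ereal"
  assumes f: "proper f" "convex_fun f" and "\<gamma> > 0" and p: "p \<in> prox \<gamma> f z"
  shows "(1 / \<gamma>) *\<^sub>R (z - p) \<in> subdifferential f p"
proof -
  define \<Psi> where "\<Psi> = (\<lambda>x. ereal (1/2 * (norm (x - z))\<^sup>2) + ereal \<gamma> * f x)"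
  have min: "\<Psi> p \<le> \<Psi> y" for y
    using p unfolding prox_def Argmin_def is_arg_min_linorder \<Psi>_def by auto
  obtain y0 where "f y0 \<noteq> \<infinity>" using f(1) by (auto simp: proper_def)
  then obtain s0 where "f y0 = ereal s0" using f(1) by (cases "f y0") (auto simp: proper_def)
  then have "\<Psi> p \<noteq> \<infinity>" using min[of y0] by (auto simp: \<Psi>_def)
  then have "f p \<noteq> \<infinity>" using \<open>\<gamma> > 0\<close> by (auto simp: \<Psi>_def)
  then obtain r where r: "f p = ereal r" using f(1) by (cases "f p") (auto simp: proper_def)
  have "r + ((1 / \<gamma>) *\<^sub>R (z - p)) \<bullet> (y - p) \<le> s" if s: "f y = ereal s" for y s
  proof -
    define h where "h = y - p"
    have *: "(z - p) \<bullet> h \<le> \<gamma> * (s - r) + t / 2 * (norm h)\<^sup>2" if t: "0 < t" "t < 1" for t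
    proof -
      have le1: "f (p + t *\<^sub>R h) \<le> ereal (r + t * (s - r))"
        unfolding h_def using t by (intro convex_fun_le[OF f(2) r s]) auto
      have "\<Psi> p \<le> \<Psi> (p + t *\<^sub>R h)" by (rule min)
      also have "\<dots> \<le> ereal (1/2 * (norm (p + t *\<^sub>R h - z))\<^sup>2) + ereal \<gamma> * ereal (r + t * (s - r))"
        unfolding \<Psi>_def using le1 \<open>\<gamma> > 0\<close> by (intro add_left_mono ereal_mult_left_mono) auto
      finally have "1/2 * (norm (p - z))\<^sup>2 + \<gamma> * r \<le>
          1/2 * (norm (p + t *\<^sub>R h - z))\<^sup>2 + \<gamma> * (r + t * (s - r))"
        unfolding \<Psi>_def r by simp
      moreover have "(norm (p + t *\<^sub>R h - z))\<^sup>2 =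
          (norm (p - z))\<^sup>2 - 2 * t * ((z - p) \<bullet> h) + t\<^sup>2 * (norm h)\<^sup>2"
        unfolding power2_norm_eq_inner
        by (simp add: inner_diff_left inner_diff_right inner_add_left inner_add_right
            inner_commute algebra_simps power2_eq_square)
      ultimately have "t * ((z - p) \<bullet> h) \<le> t * (\<gamma> * (s - r) + t / 2 * (norm h)\<^sup>2)"
        by (simp add: algebra_simps power2_eq_square)
      then show ?thesis using t by simp
    qed
    have lim: "((\<lambda>t. \<gamma> * (s - r) + t / 2 * (norm h)\<^sup>2) \<longlongrightarrow> \<gamma> * (s - r) + 0 / 2 * (norm h)\<^sup>2)
        (at_right 0)"
      by (intro tendsto_intros) auto
    have "\<forall>\<^sub>F t in at_right (0::real). t \<in> {0<..<1}"
      by (rule eventually_at_right_real) simp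
    then have "\<forall>\<^sub>F t in at_right 0. (z - p) \<bullet> h \<le> \<gamma> * (s - r) + t / 2 * (norm h)\<^sup>2"
      by eventually_elim (use * in auto)
    then have "(z - p) \<bullet> h \<le> \<gamma> * (s - r)"
      using tendsto_lowerbound[OF lim] by simp
    then have "(z - p) \<bullet> h / \<gamma> \<le> s - r" using \<open>\<gamma> > 0\<close> by (simp add: pos_divide_le_eq mult.commute)
    then show ?thesis by (simp add: h_def)
  qed
  then show ?thesis by (intro subdifferential_local[OF f r open_UNIV]) auto
qed

section \<open>The subspace \<open>T_space\<close> and its normal space\<close>

lemma subspace_T_space: "subspace (T_space R x)"
  unfolding T_space_def by (rule subspace_orthogonal_comp)

text \<open>Differences of subgradients lie in \<open>par\<close>, to which \<open>T_space\<close>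
  is orthogonal. In the polyhedral case this refutes the separating hyperplane.\<close>

lemma T_space_inner_eq:
  assumes "h \<in> T_space R x" "u \<in> subdifferential R x" "v \<in> subdifferential R x"
  shows "u \<bullet> h = v \<bullet> h"
proof -
  have "1 *\<^sub>R (u - v) \<in> par (subdifferential R x)"
    unfolding par_def using assms by blast
  then have "(u - v) \<bullet> h = 0"
    using assms(1) by (auto simp: T_space_def orthogonal_comp_def orthogonal_def)
  then show ?thesis by (simp add: inner_diff_left)
qed

text \<open>The normal space lies in the direction space of the affine hull of the subdifferential,
  and a ball of that hull around \<open>u\<close> stays in the subdifferential.\<close>

lemma rel_interior_normal_ball:
  fixes R :: "'a::euclidean_space \<Rightarrow> ereal"
  assumes u: "u \<in> rel_interior (subdifferential R x)"
  obtains e where "e > 0"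
    "\<And>n. n \<in> (T_space R x)\<^sup>\<bottom> \<Longrightarrow> norm n < e \<Longrightarrow> u + n \<in> subdifferential R x"
proof -
  let ?C = "subdifferential R x"
  obtain e where e: "e > 0" "ball u e \<inter> affine hull ?C \<subseteq> ?C" and uC: "u \<in> ?C"
    using u by (auto simp: mem_rel_interior_ball)
  have "u + n \<in> ?C" if n: "n \<in> (T_space R x)\<^sup>\<bottom>" "norm n < e" for n
  proof -
    \<comment> \<open>The form in which \<open>affine_hull_span\<close> generates the direction
      space. The inclusion of \<open>par\<close> in its span suffices, so \<open>par\<close> need
      not be shown closed under addition.\<close>
    let ?D = "{y - u |y. y \<in> ?C - {u}}"
    have D: "c - u \<in> span ?D" if "c \<in> ?C" for c
      using that by (cases "c = u") (auto intro: span_base simp: span_zero)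
    have "par ?C \<subseteq> span ?D"
    proof
      fix z assume "z \<in> par ?C"
      then obtain c p q where z: "z = c *\<^sub>R (p - q)" "p \<in> ?C" "q \<in> ?C" by (auto simp: par_def)
      have "c *\<^sub>R ((p - u) - (q - u)) \<in> span ?D"
        by (intro span_scale span_diff D z)
      then show "z \<in> span ?D" by (simp add: z)
    qed
    then have "(span ?D)\<^sup>\<bottom> \<subseteq> T_space R x"
      unfolding T_space_def by (rule orthogonal_comp_anti_mono)
    then have "(T_space R x)\<^sup>\<bottom> \<subseteq> ((span ?D)\<^sup>\<bottom>)\<^sup>\<bottom>" by (rule orthogonal_comp_anti_mono)
    also have "\<dots> = span ?D" by (intro orthogonal_comp_self subspace_span)
    finally have "n \<in> span ?D" using n by auto
    then have "u + n \<in> affine hull ?C" using affine_hull_span[OF uC] by auto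
    then show ?thesis using e n by (auto simp: dist_norm)
  qed
  then show thesis using that e by blast
qed

section \<open>Tangent vectors\<close>

text \<open>The difference quotients at 0 lie in \<open>S\<close>, and \<open>S\<close> is
  closed.\<close>

lemma has_vector_derivative_in_subspace:
  fixes c :: "real \<Rightarrow> 'a::euclidean_space"
  assumes c: "(c has_vector_derivative h) (at 0)" and S: "subspace S"
    and ev: "\<forall>\<^sub>F t in at 0. c t - c 0 \<in> S"
  shows "h \<in> S"
proof -
  have "((\<lambda>t. (c t - c 0 - t *\<^sub>R h) /\<^sub>R \<bar>t\<bar>) \<longlongrightarrow> 0) (at 0)"
    using c by (simp add: has_vector_derivative_def has_derivative_at_within)
  then have "((\<lambda>t. norm ((c t - c 0 - t *\<^sub>R h) /\<^sub>R \<bar>t\<bar>)) \<longlongrightarrow> 0) (at 0)"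
    by (rule tendsto_norm_zero)
  \<comment> \<open>The derivative is defined with \<open>\<bar>t\<bar>\<close>, the quotient with
    \<open>t\<close>; the norm hides the sign.\<close>
  moreover have "\<forall>\<^sub>F t in at 0. norm ((c t - c 0 - t *\<^sub>R h) /\<^sub>R \<bar>t\<bar>) =
      norm (inverse t *\<^sub>R (c t - c 0) - h)"
    unfolding eventually_at_filter
  proof (intro always_eventually allI impI)
    fix t :: real assume "t \<noteq> 0"
    then have "inverse t *\<^sub>R (c t - c 0) - h = inverse t *\<^sub>R (c t - c 0 - t *\<^sub>R h)"
      by (simp add: scaleR_diff_right)
    then show "norm ((c t - c 0 - t *\<^sub>R h) /\<^sub>R \<bar>t\<bar>) = norm (inverse t *\<^sub>R (c t - c 0) - h)"
      by simp
  qed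
  ultimately have "((\<lambda>t. norm (inverse t *\<^sub>R (c t - c 0) - h)) \<longlongrightarrow> 0) (at 0)"
    by (rule Lim_transform_eventually)
  then have lim: "((\<lambda>t. inverse t *\<^sub>R (c t - c 0)) \<longlongrightarrow> h) (at 0)"
    by (simp add: tendsto_norm_zero_iff Lim_null[symmetric])
  have "\<forall>\<^sub>F t in at 0. inverse t *\<^sub>R (c t - c 0) \<in> S"
    using ev by eventually_elim (rule subspace_scale[OF S])
  then show ?thesis
    by (rule Lim_in_closed_set[OF closed_subspace[OF S] _ _ lim]) simp
qed

lemma curve_in_eventually:
  assumes "curve_in M x c h" "open U" "x \<in> U"
  shows "\<forall>\<^sub>F t in nhds 0. c t \<in> M \<inter> U"
proof -
  obtain e where e: "e > 0" "c ` {-e<..<e} \<subseteq> M" using assms(1) by (auto simp: curve_in_def)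
  have "isCont c 0" "c 0 = x"
    using assms(1) by (auto simp: curve_in_def intro: has_vector_derivative_continuous)
  then have "(c \<longlongrightarrow> c 0) (nhds 0)" unfolding isCont_def tendsto_at_iff_tendsto_nhds by simp
  then have "\<forall>\<^sub>F t in nhds 0. c t \<in> U"
    using assms \<open>c 0 = x\<close> by (intro topological_tendstoD) auto
  moreover have "\<forall>\<^sub>F t in nhds 0. t \<in> {-e<..<e}"
    using e by (intro eventually_nhds_in_open) auto
  ultimately show ?thesis by eventually_elim (use e in auto)
qed

lemma tangent_space_affine:
  fixes M :: "'a::euclidean_space set"
  assumes T: "subspace T" and U: "open U" "z \<in> U" and z: "z \<in> M"
    and M: "M \<inter> U = (+) z ` T \<inter> U"
  shows "tangent_space M z = T"
proof (intro set_eqI iffI)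
  fix h assume "h \<in> tangent_space M z"
  then obtain c where c: "curve_in M z c h" by (auto simp: tangent_space_def)
  then have c0: "c 0 = z" "(c has_vector_derivative h) (at 0)" by (auto simp: curve_in_def)
  have "\<forall>\<^sub>F t in at 0. c t \<in> M \<inter> U"
    using curve_in_eventually[OF c U] by (simp add: eventually_nhds_conv_at)
  then have "\<forall>\<^sub>F t in at 0. c t - c 0 \<in> T"
    by eventually_elim (use M c0 in auto)
  with has_vector_derivative_in_subspace[OF c0(2) T] show "h \<in> T" .
next
  fix h assume h: "h \<in> T"
  define c where "c = (\<lambda>t::real. z + t *\<^sub>R h)"
  have d: "(c has_vector_derivative h) (at t)" for t
    unfolding c_def by (auto intro!: derivative_eq_intros)
  have "isCont c 0" using d by (rule has_vector_derivative_continuous)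
  then have "(c \<longlongrightarrow> c 0) (nhds 0)" unfolding isCont_def tendsto_at_iff_tendsto_nhds by simp
  moreover have "c 0 = z" by (simp add: c_def)
  ultimately have "\<forall>\<^sub>F t in nhds 0. c t \<in> U" using U by (intro topological_tendstoD) auto
  then obtain e where e: "e > 0" "\<And>t. dist t 0 < e \<Longrightarrow> c t \<in> U"
    by (auto simp: eventually_nhds_metric)
  have "c t \<in> (+) z ` T" for t using h T by (auto simp: c_def subspace_scale)
  then have cM: "c t \<in> M" if "dist t 0 < e" for t using e(2)[OF that] M by blast
  have "c ` {-e<..<e} \<subseteq> M" by (auto intro!: cM simp: dist_real_def)
  moreover have "c C1_differentiable_on {-e<..<e}"
    unfolding C1_differentiable_on_def using d by (intro exI[of _ "\<lambda>_. h"]) auto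
  ultimately have "curve_in M z c h"
    using e d by (auto simp: curve_in_def c_def)
  then show "h \<in> tangent_space M z" unfolding tangent_space_def by blast
qed

text \<open>Along a curve in \<open>M\<close> with velocity \<open>h\<close> at \<open>p\<close>,
  the squared distance to \<open>z\<close> is minimal at 0, where its derivative is
  \<open>-2 * ((z - p) \<bullet> h)\<close>.\<close>

lemma nearest_point_normal:
  fixes M :: "'a::euclidean_space set"
  assumes h: "h \<in> tangent_space M p" and U: "open U" "p \<in> U"
    and min: "\<And>q. q \<in> M \<inter> U \<Longrightarrow> dist z p \<le> dist z q"
  shows "(z - p) \<bullet> h = 0"
proof -
  obtain c where c: "curve_in M p c h" using h by (auto simp: tangent_space_def)
  then have c0: "c 0 = p" "(c has_vector_derivative h) (at 0)" by (auto simp: curve_in_def)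
  define f where "f = (\<lambda>t. (z - c t) \<bullet> (z - c t))"
  have cd: "(c has_derivative (\<lambda>t. t *\<^sub>R h)) (at 0)"
    using c0 by (simp add: has_vector_derivative_def)
  have f': "(f has_derivative (\<lambda>t. - 2 * t * ((z - p) \<bullet> h))) (at 0)"
    unfolding f_def using c0
    by (auto intro!: derivative_eq_intros cd simp: inner_commute algebra_simps)
  have "\<forall>\<^sub>F t in nhds 0. f 0 \<le> f t"
    using curve_in_eventually[OF c U]
  proof eventually_elim
    case (elim t)
    then have "dist z p \<le> dist z (c t)" by (intro min)
    then show ?case using c0 unfolding f_def dist_norm
      by (simp add: norm_le)
  qed
  then obtain e where e: "e > 0" "\<And>t. dist t 0 < e \<Longrightarrow> f 0 \<le> f t"
    by (auto simp: eventually_nhds_metric)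
  have "(\<lambda>t. - 2 * t * ((z - p) \<bullet> h)) = (\<lambda>v. 0)"
    by (rule differential_zero_maxmin[of 0 "ball 0 e"])
       (use e f' in \<open>auto simp: dist_commute\<close>)
  from fun_cong[OF this, of 1] show ?thesis by simp
qed

text \<open>In the straightening chart all tangent spaces near \<open>x\<close> become the same
  \<open>S\<close>. The vector \<open>v\<close> representing \<open>h\<close> there is carried back
  by the derivative of \<open>\<psi>\<close> at \<open>\<phi> (p k)\<close>, which varies
  continuously.\<close>

lemma tangent_space_inner_semicontinuous:
  fixes M :: "'a::euclidean_space set"
  assumes M: "C2_submanifold_around M x" and h: "h \<in> tangent_space M x"
    and p: "\<And>k. p k \<in> M" "p \<longlonglongrightarrow> x"
  shows "\<exists>g. (\<forall>\<^sub>F k in sequentially. g k \<in> tangent_space M (p k)) \<and> g \<longlonglongrightarrow> h"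
proof -
  obtain U V :: "'a set" and \<phi> \<psi> S where U: "open U" "x \<in> U" and V: "open V"
    and hom: "homeomorphism U V \<phi> \<psi>" and C2: "C2_on U \<phi>" "C2_on V \<psi>"
    and S: "subspace S" and im: "\<phi> ` (M \<inter> U) = V \<inter> S" and xM: "x \<in> M"
    using M unfolding C2_submanifold_around_def by blast
  note hom_simps = homeomorphism_apply1[OF hom] homeomorphism_apply2[OF hom]
  have UV: "\<And>y. y \<in> U \<Longrightarrow> \<phi> y \<in> V" "\<And>y. y \<in> V \<Longrightarrow> \<psi> y \<in> U"
    using hom by (auto simp: homeomorphism_def)
  have chart: "\<psi> s \<in> M" if "s \<in> V" "s \<in> S" for s
  proof -
    have "s \<in> \<phi> ` (M \<inter> U)" unfolding im using that by simp
    then obtain y where "y \<in> M" "y \<in> U" "s = \<phi> y" by blast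
    then show ?thesis using hom_simps by simp
  qed
  obtain \<phi>' where \<phi>': "\<And>y. y \<in> U \<Longrightarrow> (\<phi> has_derivative blinfun_apply (\<phi>' y)) (at y)"
    using C2(1) by (auto simp: C2_on_def)
  obtain \<psi>' \<psi>'' where \<psi>': "\<And>y. y \<in> V \<Longrightarrow> (\<psi> has_derivative blinfun_apply (\<psi>' y)) (at y)"
    and \<psi>'': "\<And>y. y \<in> V \<Longrightarrow> (\<psi>' has_derivative blinfun_apply (\<psi>'' y)) (at y)"
    using C2(2) unfolding C2_on_def by blast
  have \<psi>'c: "isCont \<psi>' y" if "y \<in> V" for y
    using \<psi>''[OF that] by (rule has_derivative_continuous)
  obtain c where c: "curve_in M x c h" using h by (auto simp: tangent_space_def)
  then have c0: "c 0 = x" "(c has_vector_derivative h) (at 0)" by (auto simp: curve_in_def)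
  define v where "v = \<phi>' x h"
  have "((\<phi> \<circ> c) has_derivative (\<lambda>t. \<phi>' x (t *\<^sub>R h))) (at 0)"
    using diff_chain_at[OF c0(2)[unfolded has_vector_derivative_def], of \<phi> "\<phi>' x"] \<phi>' U c0
    by (simp add: o_def)
  then have v': "((\<phi> \<circ> c) has_vector_derivative v) (at 0)"
    by (simp add: has_vector_derivative_def v_def blinfun.scaleR_right)
  have "\<forall>\<^sub>F t in at 0. c t \<in> M \<inter> U"
    using curve_in_eventually[OF c U] by (simp add: eventually_nhds_conv_at)
  then have "\<forall>\<^sub>F t in at 0. (\<phi> \<circ> c) t - (\<phi> \<circ> c) 0 \<in> S"
  proof eventually_elim
    case (elim t)
    then have "\<phi> (c t) \<in> S" "\<phi> (c 0) \<in> S" using im c0 xM U by blast+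
    then show ?case using S by (auto intro: subspace_diff)
  qed
  with v' S have vS: "v \<in> S" by (rule has_vector_derivative_in_subspace)
  \<comment> \<open>As \<open>\<psi> \<circ> \<phi>\<close> is the identity near \<open>x\<close>,
    the chain rule shows that \<open>v\<close> is carried back to \<open>h\<close> at
    \<open>x\<close> itself.\<close>
  have "((\<psi> \<circ> \<phi>) has_derivative (\<lambda>d. \<psi>' (\<phi> x) (\<phi>' x d))) (at x)"
    using diff_chain_at[OF \<phi>'[OF U(2)] \<psi>'[OF UV(1)[OF U(2)]]] by (simp add: o_def)
  moreover have "((\<psi> \<circ> \<phi>) has_derivative (\<lambda>d. d)) (at x)"
    by (rule has_derivative_transform_within_open[OF has_derivative_ident U])
       (simp add: hom_simps)
  ultimately have "(\<lambda>d. \<psi>' (\<phi> x) (\<phi>' x d)) = (\<lambda>d. d)" by (rule has_derivative_unique)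
  then have hv: "\<psi>' (\<phi> x) v = h" unfolding v_def by meson
  define g where "g = (\<lambda>k. blinfun_apply (\<psi>' (\<phi> (p k))) v)"
  have "isCont \<phi> x" using \<phi>'[OF U(2)] by (rule has_derivative_continuous)
  then have "(\<lambda>k. \<phi> (p k)) \<longlonglongrightarrow> \<phi> x" using p(2) by (rule isCont_tendsto_compose)
  then have "(\<lambda>k. \<psi>' (\<phi> (p k))) \<longlonglongrightarrow> \<psi>' (\<phi> x)"
    using \<psi>'c UV U by (intro isCont_tendsto_compose[of _ \<psi>']) auto
  then have "g \<longlonglongrightarrow> \<psi>' (\<phi> x) v" unfolding g_def by (intro tendsto_intros)
  moreover have "\<forall>\<^sub>F k in sequentially. p k \<in> U" using p U by (intro topological_tendstoD)
  then have "\<forall>\<^sub>F k in sequentially. g k \<in> tangent_space M (p k)"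
  proof eventually_elim
    case (elim k)
    let ?s = "\<phi> (p k)"
    have s: "?s \<in> V" "?s \<in> S" using elim p(1) im UV by auto
    \<comment> \<open>The image of a straight line in \<open>S\<close>, which stays in
      \<open>V\<close> for small \<open>t\<close>; continuity of \<open>\<psi>'\<close> gives the
      regularity that \<open>curve_in\<close> demands.\<close>
    define c where "c = (\<lambda>t::real. \<psi> (?s + t *\<^sub>R v))"
    have "((\<lambda>t. ?s + t *\<^sub>R v) \<longlongrightarrow> ?s + 0 *\<^sub>R v) (nhds 0)"
      by (intro tendsto_intros filterlim_ident)
    then have "\<forall>\<^sub>F t in nhds 0. ?s + t *\<^sub>R v \<in> V" using V s by (intro topological_tendstoD) auto
    then obtain e where e: "e > 0" "\<And>t. dist t 0 < e \<Longrightarrow> ?s + t *\<^sub>R v \<in> V"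
      by (auto simp: eventually_nhds_metric)
    have eV: "?s + t *\<^sub>R v \<in> V" if "t \<in> {-e<..<e}" for t
      using that by (intro e) (auto simp: dist_real_def)
    have d: "(c has_vector_derivative \<psi>' (?s + t *\<^sub>R v) v) (at t)" if "t \<in> {-e<..<e}" for t
    proof -
      have "((\<lambda>t. ?s + t *\<^sub>R v) has_derivative (\<lambda>t. t *\<^sub>R v)) (at t)"
        by (auto intro!: derivative_eq_intros)
      from diff_chain_at[OF this \<psi>'[OF eV[OF that]]] show ?thesis
        by (simp add: has_vector_derivative_def c_def o_def blinfun.scaleR_right)
    qed
    have "isCont (\<lambda>t. \<psi>' (?s + t *\<^sub>R v) v) t" if "t \<in> {-e<..<e}" for t
    proof -
      have "isCont (\<lambda>t. ?s + t *\<^sub>R v) t" by (intro continuous_intros)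
      then have "isCont (\<lambda>t. \<psi>' (?s + t *\<^sub>R v)) t"
        using \<psi>'c[OF eV[OF that]] by (rule isCont_o2)
      then show ?thesis by (rule bounded_linear.isCont[OF blinfun.bounded_linear_left])
    qed
    then have "continuous_on {-e<..<e} (\<lambda>t. \<psi>' (?s + t *\<^sub>R v) v)"
      by (simp add: continuous_at_imp_continuous_on)
    then have "c C1_differentiable_on {-e<..<e}"
      unfolding C1_differentiable_on_def using d
      by (intro exI[of _ "\<lambda>t. \<psi>' (?s + t *\<^sub>R v) v"]) auto
    moreover have "c t \<in> M" if "t \<in> {-e<..<e}" for t
      unfolding c_def by (intro chart eV that subspace_add subspace_scale S s vS)
    then have "c ` {-e<..<e} \<subseteq> M" by blast
    moreover have "c 0 = p k" using elim by (simp add: c_def hom_simps)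
    ultimately have "curve_in M (p k) c (g k)"
      using e d[of 0] by (auto simp: curve_in_def g_def)
    then show ?case unfolding tangent_space_def by blast
  qed
  ultimately show ?thesis unfolding hv by blast
qed

text \<open>Inside the chart domain \<open>M\<close> is the preimage of the closed subspace
  \<open>S\<close>. Since \<open>M\<close> need not be closed globally, nearest points are taken in
  such a compact piece.\<close>

lemma submanifold_locally_compact:
  fixes M :: "'a::euclidean_space set"
  assumes M: "C2_submanifold_around M x"
  obtains d where "d > 0" "compact (M \<inter> cball x d)"
proof -
  obtain U V :: "'a set" and \<phi> \<psi> S where U: "open U" "x \<in> U"
    and hom: "homeomorphism U V \<phi> \<psi>" 
    and S: "subspace S" and im: "\<phi> ` (M \<inter> U) = V \<inter> S"
    using M unfolding C2_submanifold_around_def by blast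
  obtain d where d: "d > 0" "cball x d \<subseteq> U" using U open_contains_cball by blast
  have "y \<in> M \<longleftrightarrow> \<phi> y \<in> S" if "y \<in> U" for y
  proof
    assume "\<phi> y \<in> S"
    moreover have "\<phi> y \<in> V" using hom that by (auto simp: homeomorphism_def)
    ultimately obtain y' where "y' \<in> M" "y' \<in> U" "\<phi> y = \<phi> y'" using im by blast
    then show "y \<in> M" using homeomorphism_apply1[OF hom] that by metis
  qed (use im that in blast)
  then have eq: "M \<inter> cball x d = cball x d \<inter> \<phi> -` S" using d by blast
  have "continuous_on (cball x d) \<phi>"
    using hom d by (auto simp: homeomorphism_def intro: continuous_on_subset)
  then have "closed (cball x d \<inter> \<phi> -` S)"
    by (rule continuous_closed_preimage[OF _ closed_cball closed_subspace[OF S]])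
  then have "compact (M \<inter> cball x d)"
    unfolding eq by (metis bounded_cball bounded_Int compact_eq_bounded_closed)
  then show thesis using that d by blast
qed

section \<open>Finite identification\<close>

text \<open>The points \<open>p k\<close> are projections onto a compact piece of \<open>M\<close>.
  As \<open>x\<close> competes, \<open>p k\<close> is at most twice as far from \<open>x\<close> as
  \<open>z k\<close>, so it converges too.\<close>

lemma nearest_points_in_submanifold:
  fixes M :: "'a::euclidean_space set"
  assumes M: "C2_submanifold_around M x" and z: "z \<longlonglongrightarrow> x"
  obtains p where "\<And>k. p k \<in> M" "p \<longlonglongrightarrow> x"
    "\<forall>\<^sub>F k in sequentially. \<forall>h\<in>tangent_space M (p k). (z k - p k) \<bullet> h = 0"
proof -
  obtain d where d: "d > 0" "compact (M \<inter> cball x d)"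
    using submanifold_locally_compact[OF M] .
  let ?Q = "M \<inter> cball x d"
  have xQ: "x \<in> ?Q" using M d by (auto simp: C2_submanifold_around_def)
  define p where "p = (\<lambda>k. closest_point ?Q (z k))"
  have Q: "closed ?Q" "?Q \<noteq> {}" using d(2) xQ compact_imp_closed by auto
  have pQ: "p k \<in> ?Q" for k unfolding p_def by (intro closest_point_in_set Q)
  have le: "dist (z k) (p k) \<le> dist (z k) y" if "y \<in> ?Q" for y k
    unfolding p_def by (rule closest_point_le[OF Q(1) that])
  have "(\<lambda>k. 2 * dist (z k) x) \<longlonglongrightarrow> 2 * 0"
    using z by (intro tendsto_intros) (simp add: tendsto_dist_iff[symmetric])
  then have lim2: "(\<lambda>k. 2 * dist (z k) x) \<longlonglongrightarrow> 0" by simp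
  have "dist (p k) x \<le> 2 * dist (z k) x" for k
    using le[OF xQ, of k] dist_triangle3[of "p k" x "z k"] by simp
  then have "(\<lambda>k. dist (p k) x) \<longlonglongrightarrow> 0"
    by (intro tendsto_sandwich[OF _ _ tendsto_const lim2]) auto
  then have px: "p \<longlonglongrightarrow> x" by (simp add: tendsto_dist_iff[symmetric])
  \<comment> \<open>In the open ball, minimality over the truncated piece is minimality over
    \<open>M\<close> near \<open>p k\<close>.\<close>
  have "\<forall>\<^sub>F k in sequentially. p k \<in> ball x d"
    using px d by (intro topological_tendstoD) auto
  then have "\<forall>\<^sub>F k in sequentially. \<forall>h\<in>tangent_space M (p k). (z k - p k) \<bullet> h = 0"
  proof eventually_elim
    case (elim k)
    then show ?case
      by (intro ballI nearest_point_normal[OF _ open_ball elim]) (auto intro: le)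
  qed
  then show thesis using that pQ px by blast
qed

text \<open>The case of a sequence that avoids \<open>M\<close> altogether, so that
  \<open>z k - p k\<close> can be normalised for every \<open>k\<close>.\<close>

lemma identification_contradiction:
  fixes R :: "'a::euclidean_space \<Rightarrow> ereal"
  assumes R: "proper R" and ps: "partly_smooth R x M"
    and u: "u \<in> rel_interior (subdifferential R x)"
    and z: "z \<longlonglongrightarrow> x" and w: "\<And>k. w k \<in> subdifferential R (z k)" "w \<longlonglongrightarrow> u"
    and nM: "\<And>k. z k \<notin> M"
  shows False
proof -
  have M: "C2_submanifold_around M x" and T: "tangent_space M x = T_space R x"
    and cont: "set_valued_continuous_at_relative (subdifferential R) x M"
    using ps by (auto simp: partly_smooth_def)
  obtain p where p: "\<And>k. p k \<in> M" "p \<longlonglongrightarrow> x"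
    and normal: "\<forall>\<^sub>F k in sequentially. \<forall>h\<in>tangent_space M (p k). (z k - p k) \<bullet> h = 0"
    using nearest_points_in_submanifold[OF M z] by blast
  define d where "d = (\<lambda>k. (1 / norm (z k - p k)) *\<^sub>R (z k - p k))"
  have pos: "norm (z k - p k) > 0" for k using p(1)[of k] nM[of k] by auto
  have "d k \<in> sphere 0 1" for k using pos[of k] by (simp add: d_def)
  then obtain l r where l: "l \<in> sphere 0 1" and r: "strict_mono r" and dl: "(d \<circ> r) \<longlonglongrightarrow> l"
    using compact_sphere[of "0::'a" 1] unfolding compact_def by metis
  \<comment> \<open>By sharpness \<open>h\<close> is tangent at \<open>x\<close>, hence a limit of
    tangent vectors at \<open>p k\<close>, to which \<open>d k\<close> is orthogonal.\<close>
  have "h \<bullet> l = 0" if h: "h \<in> T_space R x" for h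
  proof -
    obtain g where g: "\<forall>\<^sub>F k in sequentially. g k \<in> tangent_space M (p k)" "g \<longlonglongrightarrow> h"
      using tangent_space_inner_semicontinuous[OF M _ p] h T by metis
    have "\<forall>\<^sub>F k in sequentially. g k \<bullet> d k = 0"
      using g(1) normal by eventually_elim (auto simp: d_def inner_commute)
    then have ev: "\<forall>\<^sub>F k in sequentially. g (r k) \<bullet> d (r k) = 0"
      using r by (rule eventually_subseq[rotated])
    have "(\<lambda>k. g (r k) \<bullet> d (r k)) \<longlonglongrightarrow> h \<bullet> l"
      using LIMSEQ_subseq_LIMSEQ[OF g(2) r] dl by (intro tendsto_inner) (auto simp: o_def)
    then show ?thesis using tendsto_eventually[OF ev] LIMSEQ_unique by blast
  qed
  then have lN: "l \<in> (T_space R x)\<^sup>\<bottom>" by (auto simp: orthogonal_comp_def orthogonal_def)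
  obtain e where e: "e > 0"
    "\<And>n. n \<in> (T_space R x)\<^sup>\<bottom> \<Longrightarrow> norm n < e \<Longrightarrow> u + n \<in> subdifferential R x"
    using rel_interior_normal_ball[OF u] by blast
  \<comment> \<open>Half of \<open>e\<close> keeps the normal perturbation inside the radius in
    which it yields subgradients.\<close>
  define v where "v = u + (e / 2) *\<^sub>R l"
  have "(e / 2) *\<^sub>R l \<in> (T_space R x)\<^sup>\<bottom>" 
    using lN by (intro subspace_scale subspace_orthogonal_comp)
  then have "v \<in> subdifferential R x" unfolding v_def using e(1) l by (intro e(2)) auto
  then obtain w' where w': "\<forall>\<^sub>F k in sequentially. w' k \<in> subdifferential R (p k)" "w' \<longlonglongrightarrow> v"
    using cont p unfolding set_valued_continuous_at_relative_def by metis
  \<comment> \<open>Monotonicity between \<open>z k\<close> and \<open>p k\<close>, divided by their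
    distance.\<close>
  have "\<forall>\<^sub>F k in sequentially. 0 \<le> (w k - w' k) \<bullet> d k"
    using w'(1)
  proof eventually_elim
    case (elim k)
    have "0 \<le> (w k - w' k) \<bullet> (z k - p k)" by (rule subdifferential_monotone[OF R w(1) elim])
    then show ?case by (simp add: d_def)
  qed
  then have ev: "\<forall>\<^sub>F k in sequentially. 0 \<le> (w (r k) - w' (r k)) \<bullet> d (r k)"
    using r by (rule eventually_subseq[rotated])
  have "(\<lambda>k. (w (r k) - w' (r k)) \<bullet> d (r k)) \<longlonglongrightarrow> (u - v) \<bullet> l"
    using LIMSEQ_subseq_LIMSEQ[OF w(2) r] LIMSEQ_subseq_LIMSEQ[OF w'(2) r] dl
    by (intro tendsto_inner tendsto_diff) (auto simp: o_def)
  then have "0 \<le> (u - v) \<bullet> l" using tendsto_lowerbound[OF _ ev] by simp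
  moreover have "(u - v) \<bullet> l = - (e / 2)"
    using l by (simp add: v_def dot_square_norm)
  ultimately show False using e(1) by simp
qed

text \<open>Infinitely many failures form a subsequence outside \<open>M\<close>, to which the
  hypotheses pass.\<close>

lemma identification:
  fixes R :: "'a::euclidean_space \<Rightarrow> ereal"
  assumes R: "proper R" and ps: "partly_smooth R x M"
    and u: "u \<in> rel_interior (subdifferential R x)"
    and z: "z \<longlonglongrightarrow> x" and w: "\<And>k. w k \<in> subdifferential R (z k)" "w \<longlonglongrightarrow> u"
  shows "\<forall>\<^sub>F k in sequentially. z k \<in> M"
proof (rule ccontr)
  assume "\<not> ?thesis"
  then obtain r :: "nat \<Rightarrow> nat" where r: "strict_mono r" "\<And>k. z (r k) \<notin> M"
    using not_eventually_sequentiallyD by blast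
  show False
    using identification_contradiction[OF R ps u LIMSEQ_subseq_LIMSEQ[OF z r(1)] _
        LIMSEQ_subseq_LIMSEQ[OF w(2) r(1)]] w(1) r(2) by (simp add: o_def)
qed

section \<open>Polyhedral functions\<close>

text \<open>A half-space active at \<open>p\<close> contributes its cone of admissible directions,
  an inactive one imposes nothing within a small radius. As there are finitely many, a common radius
  exists.\<close>

lemma polyhedron_tangent_cone:
  fixes S :: "'a::euclidean_space set"
  assumes "polyhedron S" "p \<in> S"
  obtains K e where "closed K" "convex K" "cone K" "e > 0"
    "\<And>d. p + d \<in> S \<Longrightarrow> d \<in> K" "\<And>d. d \<in> K \<Longrightarrow> norm d < e \<Longrightarrow> p + d \<in> S"
proof -
  obtain H where H: "finite H" "S = \<Inter> H"
    and half: "\<And>h. h \<in> H \<Longrightarrow> \<exists>a b. a \<noteq> 0 \<and> h = {x. a \<bullet> x \<le> b}"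
    using assms(1) unfolding polyhedron_def by blast
  have "\<exists>K e. closed K \<and> convex K \<and> cone K \<and> e > 0 \<and> (\<forall>d. p + d \<in> h \<longrightarrow> d \<in> K) \<and>
      (\<forall>d\<in>K. norm d < e \<longrightarrow> p + d \<in> h)" if h: "h \<in> H" for h
  proof -
    obtain a b where ab: "h = {x. a \<bullet> x \<le> b}" using half[OF h] by blast
    have "p \<in> h" using assms H h by blast
    then consider "a \<bullet> p = b" | "a \<bullet> p < b" using ab by fastforce
    then show ?thesis
    proof cases
      case 1
      have "closed {d. a \<bullet> d \<le> 0}" "convex {d. a \<bullet> d \<le> 0}"
        by (simp_all add: closed_halfspace_le convex_halfspace_le)
      moreover have "cone {d. a \<bullet> d \<le> 0}"
        by (auto simp: cone_def mult_nonneg_nonpos)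
      ultimately show ?thesis using 1
        by (intro exI[of _ "{d. a \<bullet> d \<le> 0}"] exI[of _ 1]) (auto simp: ab inner_add_right)
    next
      case 2
      have "open {x. a \<bullet> x < b}" by (rule open_halfspace_lt)
      then obtain e where e: "e > 0" "ball p e \<subseteq> {x. a \<bullet> x < b}"
        using 2 open_contains_ball by blast
      have "p + d \<in> h" if "norm d < e" for d
      proof -
        have "p + d \<in> ball p e" using that by (simp add: dist_norm)
        then show ?thesis using e ab by force
      qed
      then show ?thesis using e(1) by (intro exI[of _ UNIV] exI[of _ e]) auto
    qed
  qed
  then obtain K e where K: "\<And>h. h \<in> H \<Longrightarrow> closed (K h) \<and> convex (K h) \<and> cone (K h) \<and> e h > 0 \<and>
      (\<forall>d. p + d \<in> h \<longrightarrow> d \<in> K h) \<and> (\<forall>d\<in>K h. norm d < e h \<longrightarrow> p + d \<in> h)"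
    by metis
  \<comment> \<open>The inserted 1 keeps the minimum defined when \<open>H\<close> is empty.\<close>
  define \<epsilon> where "\<epsilon> = Min (insert (1::real) (e ` H))"
  have \<epsilon>: "\<epsilon> > 0" "\<And>h. h \<in> H \<Longrightarrow> \<epsilon> \<le> e h"
    unfolding \<epsilon>_def using K H(1) by auto
  show thesis
  proof (rule that[of "\<Inter>h\<in>H. K h" \<epsilon>])
    show "closed (\<Inter>h\<in>H. K h)" using K by (intro closed_INT) auto
    show "convex (\<Inter>h\<in>H. K h)" using K by (intro convex_INT) auto
    show "cone (\<Inter>h\<in>H. K h)" using K by (auto simp: cone_def)
    show "\<epsilon> > 0" by (rule \<epsilon>)
    show "d \<in> (\<Inter>h\<in>H. K h)" if "p + d \<in> S" for d using that K H by auto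
    show "p + d \<in> S" if "d \<in> (\<Inter>h\<in>H. K h)" "norm d < \<epsilon>" for d
    proof -
      have "p + d \<in> h" if h: "h \<in> H" for h
      proof -
        have "norm d < e h" "d \<in> K h" using \<open>norm d < \<epsilon>\<close> \<epsilon>(2)[OF h] \<open>d \<in> _\<close> h by auto
        then show ?thesis using K[OF h] by blast
      qed
      then show ?thesis using H by auto
    qed
  qed
qed

text \<open>The tangent cone \<open>K\<close> of the epigraph contains
  \<open>(h, u \<bullet> h)\<close>, since a separating hyperplane would give a subgradient at
  \<open>x\<close> with another value on \<open>h\<close>. Near its vertex \<open>K\<close>
  describes the epigraph, so the affine minorant with slope \<open>u\<close> touches
  \<open>R\<close> at \<open>x + h\<close>.\<close>

lemma locally_polyhedral_flat:
  fixes R :: "'a::euclidean_space \<Rightarrow> ereal"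
  assumes R: "proper R" "convex_fun R" and lp: "locally_polyhedral R x"
    and u: "u \<in> subdifferential R x"
  obtains e where "e > 0"
    "\<And>h. h \<in> T_space R x \<Longrightarrow> norm h < e \<Longrightarrow> u \<in> subdifferential R (x + h)"
proof -
  obtain r where r: "R x = ereal r" using subdifferential_finite[OF R(1) u] .
  obtain P U where P: "polyhedron (epi P)" and U: "open U" "x \<in> U" and RP: "\<And>y. y \<in> U \<Longrightarrow> R y = P y"
    using lp unfolding locally_polyhedral_def by blast
  have "(x, r) \<in> epi P" using RP[OF U(2)] r by (simp add: epi_def)
  then obtain K \<delta> where K: "closed K" "convex K" "cone K" "\<delta> > 0"
    "\<And>d. (x, r) + d \<in> epi P \<Longrightarrow> d \<in> K"
    "\<And>d. d \<in> K \<Longrightarrow> norm d < \<delta> \<Longrightarrow> (x, r) + d \<in> epi P"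
    using polyhedron_tangent_cone[OF P] by metis
  \<comment> \<open>The vertical direction shows that \<open>K\<close> is nonempty and later forces
    \<open>q \<ge> 0\<close>.\<close>
  have "(0, 1) \<in> K" using RP[OF U(2), symmetric] r by (intro K(5)) (simp add: epi_def)
  have uR: "r + u \<bullet> (y - x) \<le> s" if "R y = ereal s" for y s
  proof -
    have "R y \<ge> R x + ereal (u \<bullet> (y - x))" using u by (simp add: subdifferential_def)
    then show ?thesis using that r by simp
  qed
  have inK: "(h, u \<bullet> h) \<in> K" if h: "h \<in> T_space R x" for h
  proof (rule ccontr)
    assume "\<not> ?thesis"
    then obtain c b where cb: "c \<bullet> (h, u \<bullet> h) < b" "\<And>d. d \<in> K \<Longrightarrow> c \<bullet> d > b"
      using separating_hyperplane_closed_point[OF K(2,1)] by blast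
    obtain p q where c: "c = (p, q)" by (cases c)
    have "0 \<in> K" using K(3) \<open>(0, 1) \<in> K\<close> cone_0 cone_contains_0 by blast
    then have b: "b < 0" using cb(2)[of 0] by simp
    \<comment> \<open>A linear functional bounded below on a cone is nonnegative: otherwise the
      positive factor \<open>b / (c \<bullet> d)\<close> scales \<open>d\<close> to a point of value
      exactly \<open>b\<close>.\<close>
    have ge: "c \<bullet> d \<ge> 0" if "d \<in> K" for d
    proof (rule ccontr)
      assume "\<not> c \<bullet> d \<ge> 0"
      then have neg: "c \<bullet> d < 0" by simp
      have "(b / (c \<bullet> d)) *\<^sub>R d \<in> K"
        using K(3) that b neg by (simp add: cone_def divide_nonpos_neg)
      from cb(2)[OF this] show False using neg by simp
    qed
    have q: "q \<ge> 0" using ge[OF \<open>(0, 1) \<in> K\<close>] by (simp add: c)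
    \<comment> \<open>Adding \<open>r + u \<bullet> (y - x) \<le> R y\<close> to the inequality of the separating hyperplane covers the
      vertical case \<open>q = 0\<close> as well.\<close>
    define v where "v = (1 / (1 + q)) *\<^sub>R (u - p)"
    have "v \<in> subdifferential R x"
    proof (rule subdifferential_local[OF R r U])
      fix y s assume y: "y \<in> U" "R y = ereal s"
      have "(y - x, s - r) \<in> K" using y RP[OF y(1)] by (intro K(5)) (simp add: epi_def)
      from ge[OF this] have "p \<bullet> (y - x) + q * (s - r) \<ge> 0" by (simp add: c)
      moreover have "r + u \<bullet> (y - x) \<le> s" using uR y by blast
      ultimately have "(u - p) \<bullet> (y - x) \<le> (s - r) * (1 + q)"
        by (simp add: inner_diff_left algebra_simps)
      then have "v \<bullet> (y - x) \<le> s - r"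
        unfolding v_def using q by (simp add: pos_divide_le_eq)
      then show "r + v \<bullet> (y - x) \<le> s" by simp
    qed
    then have "v \<bullet> h = u \<bullet> h" using T_space_inner_eq[OF h _ u] by blast
    then have "(u - p) \<bullet> h / (1 + q) = u \<bullet> h" by (simp add: v_def)
    then have "(u - p) \<bullet> h = (u \<bullet> h) * (1 + q)" using q by (simp add: divide_eq_eq)
    then have "c \<bullet> (h, u \<bullet> h) = 0" by (simp add: c inner_diff_left algebra_simps)
    then show False using cb(1) b by simp
  qed
  obtain \<eta> where \<eta>: "\<eta> > 0" "ball x \<eta> \<subseteq> U" using U open_contains_ball by blast
  \<comment> \<open>\<open>\<eta>\<close> keeps \<open>x + h\<close> where \<open>R\<close> equals
    \<open>P\<close>; the other bound makes \<open>(h, u \<bullet> h)\<close> shorter than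
    \<open>\<delta>\<close>.\<close>
  define e where "e = min \<eta> (\<delta> / (1 + norm u))"
  have np: "1 + norm u > 0" by (simp add: add_pos_nonneg)
  have "u \<in> subdifferential R (x + h)" if h: "h \<in> T_space R x" "norm h < e" for h
  proof -
    have "norm (h, u \<bullet> h) \<le> norm h + norm (u \<bullet> h)" by (rule norm_Pair_le)
    also have "\<dots> \<le> norm h * (1 + norm u)"
      using Cauchy_Schwarz_ineq2[of u h] by (simp add: algebra_simps)
    also have "\<dots> < \<delta>" using h(2) np by (simp add: e_def pos_less_divide_eq)
    finally have "(x, r) + (h, u \<bullet> h) \<in> epi P" by (intro K(6) inK h)
    moreover have "x + h \<in> U" using h(2) \<eta> by (auto simp: e_def dist_norm)
    ultimately have le: "R (x + h) \<le> ereal (r + u \<bullet> h)" using RP by (simp add: epi_def)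
    have "R (x + h) \<noteq> -\<infinity>" using R(1) by (auto simp: proper_def)
    with le obtain s where s: "R (x + h) = ereal s" "s \<le> r + u \<bullet> h" by (cases "R (x + h)") auto
    show ?thesis
    proof (rule subdifferential_local[OF R s(1) open_UNIV UNIV_I])
      fix y t assume "R y = ereal t"
      from uR[OF this] show "s + u \<bullet> (y - (x + h)) \<le> t"
        using s(2) by (simp add: inner_diff_right inner_add_right)
    qed
  qed
  then show thesis using that[of e] \<eta>(1) K(4) np by (simp add: e_def)
qed

text \<open>Points of the affine space near \<open>x\<close> lie in \<open>M\<close> by
  identification with the constant subgradient \<open>u\<close>. Conversely, by nondegeneracy a
  normal component \<open>n\<close> raises \<open>R\<close> above slope \<open>u\<close> by a fixed
  multiple of \<open>norm n\<close>, while subgradients close to \<open>u\<close> at points of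
  \<open>M\<close> allow only a smaller one.\<close>

lemma locally_polyhedral_partly_smooth:
  fixes R :: "'a::euclidean_space \<Rightarrow> ereal"
  assumes R: "proper R" "convex_fun R" and ps: "partly_smooth R x M"
    and lp: "locally_polyhedral R x" and u: "u \<in> rel_interior (subdifferential R x)"
    and r: "R x = ereal r"
  obtains W where "open W" "x \<in> W" "M \<inter> W = (+) x ` T_space R x \<inter> W"
    "\<And>y. y \<in> M \<inter> W \<Longrightarrow> R y = ereal (r + u \<bullet> (y - x))"
proof -
  let ?T = "T_space R x"
  have uR: "u \<in> subdifferential R x" using u rel_interior_subset by blast
  have cont: "set_valued_continuous_at_relative (subdifferential R) x M"
    using ps by (simp add: partly_smooth_def)
  obtain e where e: "e > 0"
    and flat: "\<And>h. h \<in> ?T \<Longrightarrow> norm h < e \<Longrightarrow> u \<in> subdifferential R (x + h)"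
    using locally_polyhedral_flat[OF R lp uR] by blast
  have val: "R (x + h) = ereal (r + u \<bullet> h)" if h: "h \<in> ?T" "norm h < e" for h
  proof -
    have f: "u \<in> subdifferential R (x + h)" using flat h by blast
    then obtain s where s: "R (x + h) = ereal s" using subdifferential_finite[OF R(1)] by blast
    \<comment> \<open>The same \<open>u\<close> at both points gives opposite inequalities, which
      fix the value.\<close>
    have "R (x + h) \<ge> R x + ereal (u \<bullet> ((x + h) - x))"
      "R x \<ge> R (x + h) + ereal (u \<bullet> (x - (x + h)))"
      using uR f unfolding subdifferential_def by blast+
    then show ?thesis using r s by simp
  qed
  let ?A = "(+) x ` (?T \<inter> ball 0 e)"
  have "\<forall>\<^sub>F y in inf (nhds x) (principal ?A). y \<in> M"
  proof (intro sequentially_imp_eventually_nhds_within allI impI)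
    fix z assume z: "(\<forall>n. z n \<in> ?A) \<and> z \<longlonglongrightarrow> x"
    have "u \<in> subdifferential R (z n)" for n
    proof -
      obtain h where "h \<in> ?T \<inter> ball 0 e" "z n = x + h" using z by blast
      then show ?thesis using flat by simp
    qed
    then show "\<forall>\<^sub>F n in sequentially. z n \<in> M"
      using z by (intro identification[OF R(1) ps u, of z "\<lambda>_. u"]) auto
  qed
  then have ev1: "\<forall>\<^sub>F y in nhds x. y \<in> ?A \<longrightarrow> y \<in> M" by (simp add: eventually_inf_principal)
  obtain \<epsilon> where \<epsilon>: "\<epsilon> > 0"
    "\<And>n. n \<in> ?T\<^sup>\<bottom> \<Longrightarrow> norm n < \<epsilon> \<Longrightarrow> u + n \<in> subdifferential R x"
    using rel_interior_normal_ball[OF u] by blast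
  have "\<forall>\<^sub>F y in inf (nhds x) (principal M). y \<in> (+) x ` ?T"
  proof (intro sequentially_imp_eventually_nhds_within allI impI)
    fix z assume z: "(\<forall>k. z k \<in> M) \<and> z \<longlonglongrightarrow> x"
    then obtain w where w: "\<forall>\<^sub>F k in sequentially. w k \<in> subdifferential R (z k)" "w \<longlonglongrightarrow> u"
      using cont uR unfolding set_valued_continuous_at_relative_def by metis
    have "\<forall>\<^sub>F k in sequentially. dist (w k) u < \<epsilon> / 2" "\<forall>\<^sub>F k in sequentially. dist (z k) x < e"
      using tendstoD[OF w(2), of "\<epsilon> / 2"] tendstoD[OF conjunct2[OF z] e] \<epsilon>(1) by simp_all
    with w(1) show "\<forall>\<^sub>F k in sequentially. z k \<in> (+) x ` ?T"
    proof eventually_elim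
      case (elim k)
      obtain p n where p: "p \<in> span ?T" and n: "\<And>w. w \<in> span ?T \<Longrightarrow> orthogonal n w"
        and pn: "z k - x = p + n"
        using orthogonal_subspace_decomp_exists[of ?T "z k - x"] by metis
      have pT: "p \<in> ?T" using p subspace_T_space span_eq_iff by blast
      have nN: "n \<in> ?T\<^sup>\<bottom>"
        using n span_base by (auto simp: orthogonal_comp_def orthogonal_commute)
      have "(norm p)\<^sup>2 \<le> (norm (p + n))\<^sup>2"
        using n[OF p] norm_add_Pythagorean[of p n] by (simp add: orthogonal_commute)
      then have "norm p \<le> norm (z k - x)" by (simp add: pn)
      then have "norm p < e" using elim(3) by (simp add: dist_norm)
      then have Rp: "R (x + p) = ereal (r + u \<bullet> p)" using val pT by blast
      have "n = 0"
      proof (rule ccontr)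
        assume n0: "n \<noteq> 0"
        let ?v = "(\<epsilon> / (2 * norm n)) *\<^sub>R n"
        have "?v \<in> ?T\<^sup>\<bottom>" using nN by (intro subspace_scale subspace_orthogonal_comp)
        then have v: "u + ?v \<in> subdifferential R x"
          using \<epsilon>(1) n0 by (intro \<epsilon>(2)) auto
        obtain s where s: "R (z k) = ereal s" using subdifferential_finite[OF R(1) elim(1)] .
        \<comment> \<open>The first inequality gains \<open>\<epsilon> / 2 * norm n\<close> over
          slope \<open>u\<close>; the second, taken from \<open>z k\<close> to its tangential foot
          \<open>x + p\<close>, bounds \<open>R (z k)\<close> above with slope \<open>w k\<close>,
          which is closer to \<open>u\<close> than \<open>\<epsilon> / 2\<close>.\<close>
        have "R (z k) \<ge> R x + ereal ((u + ?v) \<bullet> (z k - x))"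
          "R (x + p) \<ge> R (z k) + ereal (w k \<bullet> ((x + p) - z k))"
          using v elim(1) unfolding subdifferential_def by blast+
        moreover have "(x + p) - z k = - n" using pn by (simp add: algebra_simps)
        moreover have "n \<bullet> p = 0" using n[OF p] by (simp add: orthogonal_def)
        ultimately have "s \<ge> r + u \<bullet> p + u \<bullet> n + ?v \<bullet> n" "r + u \<bullet> p \<ge> s - w k \<bullet> n"
          using r s Rp pn by (simp_all add: inner_add_left inner_add_right)
        then have "?v \<bullet> n \<le> (w k - u) \<bullet> n" by (simp add: inner_diff_left)
        also have "\<dots> \<le> norm (w k - u) * norm n" by (rule norm_cauchy_schwarz)
        also have "\<dots> < \<epsilon> / 2 * norm n" using elim(2) n0 by (simp add: dist_norm)
        also have "\<dots> = ?v \<bullet> n" using n0 by (simp add: dot_square_norm power2_eq_square)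
        finally show False by simp
      qed
      then have "z k = x + p" using pn by (simp add: algebra_simps)
      then show ?case using pT by blast
    qed
  qed
  then have ev2: "\<forall>\<^sub>F y in nhds x. y \<in> M \<longrightarrow> y \<in> (+) x ` ?T"
    by (simp add: eventually_inf_principal)
  have ev3: "\<forall>\<^sub>F y in nhds x. y \<in> ball x e" using e by (intro eventually_nhds_in_open) auto
  from ev1 ev2 ev3 have "\<forall>\<^sub>F y in nhds x. (y \<in> ?A \<longrightarrow> y \<in> M) \<and> (y \<in> M \<longrightarrow> y \<in> (+) x ` ?T) \<and> y \<in> ball x e"
    by eventually_elim blast
  then obtain W where W: "open W" "x \<in> W"
    "\<And>y. y \<in> W \<Longrightarrow> (y \<in> ?A \<longrightarrow> y \<in> M) \<and> (y \<in> M \<longrightarrow> y \<in> (+) x ` ?T) \<and> y \<in> ball x e"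
    unfolding eventually_nhds by blast
  have WA: "y \<in> ?A" if "y \<in> W" "y \<in> (+) x ` ?T" for y
    using that W(3)[OF that(1)] by (auto simp: dist_norm)
  have "M \<inter> W = (+) x ` ?T \<inter> W" using W(3) WA by blast
  moreover have "R y = ereal (r + u \<bullet> (y - x))" if "y \<in> M \<inter> W" for y
  proof -
    have "y \<in> ?A" using that W(3) WA by blast
    then show ?thesis using val by auto
  qed
  ultimately show thesis using that W(1,2) by blast
qed

section \<open>Riemannian derivatives\<close>

text \<open>One straightening chart serves every point of \<open>M\<close> in its domain. The
  gradient and Hessian predicates at the iterates contain this condition.\<close>

lemma C2_submanifold_around_nearby:
  assumes "C2_submanifold_around M x"
  obtains U where "open U" "x \<in> U" "\<And>z. z \<in> M \<inter> U \<Longrightarrow> C2_submanifold_around M z"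
proof -
  obtain U V :: "'a set" and \<phi> \<psi> S where U: "open U" "x \<in> U" "open V" "homeomorphism U V \<phi> \<psi>"
    "C2_on U \<phi>" "C2_on V \<psi>" "subspace S" "\<phi> ` (M \<inter> U) = V \<inter> S"
    using assms unfolding C2_submanifold_around_def by blast
  have "C2_submanifold_around M z" if "z \<in> M \<inter> U" for z
    unfolding C2_submanifold_around_def using U that by blast
  then show thesis using that U by blast
qed

lemma C2_along_around_nearby:
  assumes "C2_along_around R M x"
  obtains U where "open U" "x \<in> U" "\<And>z. z \<in> U \<Longrightarrow> C2_along_around R M z"
  using assms unfolding C2_along_around_def by blast

text \<open>The difference of two gradients is the velocity of some curve in \<open>M\<close>; equal
  derivatives along it make the difference orthogonal to itself.\<close>

lemma has_riemannian_gradient_unique: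
  assumes g: "has_riemannian_gradient R M z g" and g': "has_riemannian_gradient R M z g'"
    and T: "subspace (tangent_space M z)"
  shows "g' = g"
proof -
  have "g' - g \<in> tangent_space M z"
    using g g' by (intro subspace_diff T) (auto simp: has_riemannian_gradient_def)
  then obtain c where c: "curve_in M z c (g' - g)" unfolding tangent_space_def by blast
  then have "g \<bullet> (g' - g) = g' \<bullet> (g' - g)"
    using g g' unfolding has_riemannian_gradient_def by (blast intro: DERIV_unique)
  then have "(g' - g) \<bullet> (g' - g) = 0" by (simp add: inner_diff_left)
  then show ?thesis by simp
qed

section \<open>Derivatives of a function that is affine along a flat manifold\<close>

context
  fixes R :: "'a::euclidean_space \<Rightarrow> ereal" and M T W :: "'a set" and x u g :: 'a and r :: real
  assumes T: "subspace T" and W: "open W" and MW: "M \<inter> W = (+) x ` T \<inter> W"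
    and val: "\<And>y. y \<in> M \<inter> W \<Longrightarrow> R y = ereal (r + u \<bullet> (y - x))"
    and C2: "\<And>y. y \<in> M \<inter> W \<Longrightarrow> C2_submanifold_around M y \<and> C2_along_around R M y"
    and g: "g \<in> T" "\<And>h. h \<in> T \<Longrightarrow> g \<bullet> h = u \<bullet> h"
begin

lemma tangent_space_flat:
  assumes z: "z \<in> M \<inter> W"
  shows "tangent_space M z = T"
proof -
  obtain t where t: "t \<in> T" "z = x + t" using z MW by blast
  have "(+) x ` T = (+) z ` T"
  proof (intro set_eqI iffI)
    fix y assume "y \<in> (+) x ` T"
    then obtain s where "s \<in> T" "y = x + s" by blast
    then show "y \<in> (+) z ` T" using t T by (intro image_eqI[of _ _ "s - t"]) (auto intro: subspace_diff)
  next
    fix y assume "y \<in> (+) z ` T"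
    then obtain s where "s \<in> T" "y = z + s" by blast
    then show "y \<in> (+) x ` T" using t T by (intro image_eqI[of _ _ "t + s"]) (auto intro: subspace_add)
  qed
  then show ?thesis using z MW by (intro tangent_space_affine[OF T W]) auto
qed

text \<open>Along a curve in \<open>M\<close> the derivative of \<open>R\<close> is
  \<open>u \<bullet> h\<close>; the tangential part \<open>g\<close> of \<open>u\<close> reproduces
  it because velocities lie in \<open>T\<close>.\<close>

lemma has_riemannian_gradient_flat:
  assumes z: "z \<in> M \<inter> W"
  shows "has_riemannian_gradient R M z g"
  unfolding has_riemannian_gradient_def
proof (intro conjI allI impI)
  show "C2_submanifold_around M z" "C2_along_around R M z" using C2[OF z] by auto
  show "g \<in> tangent_space M z" using tangent_space_flat[OF z] g by simp
  fix c h assume c: "curve_in M z c h"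
  then have "h \<in> T" using tangent_space_flat[OF z] unfolding tangent_space_def by blast
  have c': "(c has_derivative (\<lambda>t. t *\<^sub>R h)) (at 0)"
    using c by (simp add: curve_in_def has_vector_derivative_def)
  have "((\<lambda>t. r + u \<bullet> (c t - x)) has_derivative (\<lambda>t. t * (u \<bullet> h))) (at 0)"
    by (auto intro!: derivative_eq_intros c')
  then have d: "((\<lambda>t. r + u \<bullet> (c t - x)) has_real_derivative (u \<bullet> h)) (at 0)"
    by (simp add: has_field_derivative_def mult.commute[of _ "u \<bullet> h"] mult_commute_abs)
  have "\<forall>\<^sub>F t in nhds 0. c t \<in> M \<inter> W" using curve_in_eventually[OF c W] z by blast
  then have "\<forall>\<^sub>F t in nhds 0. real_of_ereal (R (c t)) = r + u \<bullet> (c t - x)"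
    by eventually_elim (simp add: val)
  then show "((\<lambda>t. real_of_ereal (R (c t))) has_real_derivative g \<bullet> h) (at 0)"
    unfolding g(2)[OF \<open>h \<in> T\<close>] using d by (simp add: DERIV_cong_ev)
qed

text \<open>The gradient is the constant \<open>g\<close> on \<open>M \<inter> W\<close>, so its
  derivative along every curve vanishes.\<close>

lemma has_riemannian_hessian_flat:
  assumes z: "z \<in> M \<inter> W"
  shows "has_riemannian_hessian R M z (\<lambda>h. 0)"
  unfolding has_riemannian_hessian_def
proof (intro conjI allI impI)
  show "C2_submanifold_around M z" "C2_along_around R M z" using C2[OF z] by auto
  fix c h assume c: "curve_in M z c h"
  \<comment> \<open>A definite description, so its value requires uniqueness too.\<close>
  have grad: "riemannian_gradient R M y = g" if y: "y \<in> M \<inter> W" for y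
    unfolding riemannian_gradient_def
  proof (rule the_equality)
    show "has_riemannian_gradient R M y g" by (rule has_riemannian_gradient_flat[OF y])
    then show "g' = g" if "has_riemannian_gradient R M y g'" for g'
      using that has_riemannian_gradient_unique tangent_space_flat[OF y] T by metis
  qed
  have "\<forall>\<^sub>F t in nhds 0. c t \<in> M \<inter> W" using curve_in_eventually[OF c W] z by blast
  then have ev: "\<forall>\<^sub>F t in nhds 0. riemannian_gradient R M (c t) = g"
    by eventually_elim (rule grad)
  then obtain A where A: "open A" "0 \<in> A" "\<And>t. t \<in> A \<Longrightarrow> riemannian_gradient R M (c t) = g"
    unfolding eventually_nhds by blast
  have "((\<lambda>t. riemannian_gradient R M (c t)) has_vector_derivative 0) (at 0)"
    by (rule has_vector_derivative_transform_within_open[OF has_vector_derivative_const A(1,2)])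
       (simp add: A(3))
  moreover have "closest_point (tangent_space M z) 0 = 0"
    using tangent_space_flat[OF z] T by (intro closest_point_self) (simp add: subspace_0)
  ultimately show "\<exists>v. ((\<lambda>t. riemannian_gradient R M (c t)) has_vector_derivative v) (at 0) \<and>
      0 = closest_point (tangent_space M z) v"
    by metis
qed

end

section \<open>Forward-backward iterations\<close>

lemma FB_type_inertial_tendsto:
  fixes x :: "nat \<Rightarrow> 'a::real_normed_vector"
  assumes x: "x \<longlonglongrightarrow> l" and a: "\<And>k. a k \<in> {0..1}"
  shows "(\<lambda>k. x k + a k *\<^sub>R (x k - x (k - 1))) \<longlonglongrightarrow> l"
proof -
  \<comment> \<open>An index shift removes the truncated subtraction at
    \<open>k = 0\<close>.\<close>
  have "(\<lambda>k. x (k - 1)) \<longlonglongrightarrow> l"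
    using x by (subst filterlim_sequentially_Suc[symmetric]) simp
  then have d: "(\<lambda>k. x k - x (k - 1)) \<longlonglongrightarrow> l - l" by (intro tendsto_diff x)
  have "(\<lambda>k. a k *\<^sub>R (x k - x (k - 1))) \<longlonglongrightarrow> 0"
  proof (rule Lim_null_comparison)
    show "\<forall>\<^sub>F k in sequentially. norm (a k *\<^sub>R (x k - x (k - 1))) \<le> norm (x k - x (k - 1))"
      using a by (intro always_eventually allI) (auto simp: mult_left_le_one_le)
    show "(\<lambda>k. norm (x k - x (k - 1))) \<longlonglongrightarrow> 0" using tendsto_norm[OF d] by simp
  qed
  from tendsto_add[OF x this] show ?thesis by simp
qed

text \<open>Optimality of the proximal step gives \<open>w k\<close> at the next iterate. The lower
  bound \<open>elow\<close> on the step sizes makes its part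
  \<open>(1 / \<gamma> k) *\<^sub>R (ya k - x (Suc k))\<close> vanish; the gradient part converges
  by continuity.\<close>

lemma FB_type_subgradients:
  fixes R :: "'a::real_inner \<Rightarrow> ereal"
  assumes R: "proper R" "convex_fun R" and FB: "FB_type_iterates gradF R \<beta> a b \<gamma> x ya yb"
    and lim: "x \<longlonglongrightarrow> l" and gradF: "isCont gradF l"
  shows "ya \<longlonglongrightarrow> l" "yb \<longlonglongrightarrow> l"
    "\<exists>w. (\<forall>k. w k \<in> subdifferential R (x (Suc k))) \<and> w \<longlonglongrightarrow> - gradF l"
proof -
  obtain abar bbar elow eup where ab: "abar \<le> 1" "bbar \<le> 1" and elow: "elow > 0"
    and par: "\<And>k. a k \<in> {0..abar} \<and> b k \<in> {0..bbar} \<and> \<gamma> k \<in> {elow..2 * \<beta> - eup}"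
    and ya: "\<And>k. ya k = x k + a k *\<^sub>R (x k - x (k - 1))"
    and yb: "\<And>k. yb k = x k + b k *\<^sub>R (x k - x (k - 1))"
    and prox: "\<And>k. x (Suc k) \<in> prox (\<gamma> k) R (ya k - \<gamma> k *\<^sub>R gradF (yb k))"
    using FB unfolding FB_type_iterates_def by blast
  have a01: "a k \<in> {0..1}" "b k \<in> {0..1}" for k using par[of k] ab by auto
  show yal: "ya \<longlonglongrightarrow> l" using FB_type_inertial_tendsto[OF lim a01(1)] ya by presburger
  show ybl: "yb \<longlonglongrightarrow> l" using FB_type_inertial_tendsto[OF lim a01(2)] yb by presburger
  have \<gamma>: "elow \<le> \<gamma> k" "0 < \<gamma> k" for k using par[of k] elow by auto
  define w where "w = (\<lambda>k. (1 / \<gamma> k) *\<^sub>R ((ya k - \<gamma> k *\<^sub>R gradF (yb k)) - x (Suc k)))"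
  have "w k \<in> subdifferential R (x (Suc k))" for k
    unfolding w_def by (rule prox_imp_subdifferential[OF R \<gamma>(2) prox])
  moreover have "w \<longlonglongrightarrow> - gradF l"
  proof -
    have "(\<lambda>k. ya k - x (Suc k)) \<longlonglongrightarrow> l - l"
      using LIMSEQ_Suc[OF lim] yal by (intro tendsto_diff)
    then have "(\<lambda>k. norm (ya k - x (Suc k)) / elow) \<longlonglongrightarrow> norm (l - l) / elow"
      using elow by (intro tendsto_divide tendsto_norm tendsto_const) auto
    then have 0: "(\<lambda>k. norm (ya k - x (Suc k)) / elow) \<longlonglongrightarrow> 0" by simp
    have "(\<lambda>k. (1 / \<gamma> k) *\<^sub>R (ya k - x (Suc k))) \<longlonglongrightarrow> 0"
    proof (rule Lim_null_comparison[OF _ 0], intro always_eventually allI)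
      show "norm ((1 / \<gamma> k) *\<^sub>R (ya k - x (Suc k))) \<le> norm (ya k - x (Suc k)) / elow" for k
        using \<gamma>[of k] elow by (simp add: frac_le)
    qed
    moreover have "(\<lambda>k. gradF (yb k)) \<longlonglongrightarrow> gradF l"
      using gradF ybl by (rule isCont_tendsto_compose)
    ultimately have "(\<lambda>k. (1 / \<gamma> k) *\<^sub>R (ya k - x (Suc k)) - gradF (yb k)) \<longlonglongrightarrow> 0 - gradF l"
      by (rule tendsto_diff)
    moreover have "\<gamma> k \<noteq> 0" for k using \<gamma>(2)[of k] by simp
    then have "w = (\<lambda>k. (1 / \<gamma> k) *\<^sub>R (ya k - x (Suc k)) - gradF (yb k))"
      by (simp add: w_def scaleR_diff_right fun_eq_iff)
    ultimately show ?thesis by simp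
  qed
  ultimately show "\<exists>w. (\<forall>k. w k \<in> subdifferential R (x (Suc k))) \<and> w \<longlonglongrightarrow> - gradF l" by blast
qed

text \<open>The tangent space of an affine set is its direction space, which sharpness identifies
  with \<open>T_space R x\<close>.\<close>

lemma partly_smooth_affine:
  assumes ps: "partly_smooth R x M" and M: "affine M"
  shows "M = (+) x ` T_space R x"
proof -
  have xM: "x \<in> M" and T: "tangent_space M x = T_space R x"
    using ps by (auto simp: partly_smooth_def)
  let ?S = "(\<lambda>y. y - x) ` M"
  have eq: "(+) x ` ?S = M" by (simp add: image_image)
  have "tangent_space M x = ?S"
    by (rule tangent_space_affine[OF affine_diffs_subspace_subtract[OF M xM] open_UNIV UNIV_I xM])
       (simp add: eq)
  then show ?thesis using T eq by simp
qed

text \<open>The polyhedral case compares germs, since partial smoothness constrains \<open>M\<close>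
  only near \<open>xstar\<close>. A common \<open>g\<close> expresses the equality of
  gradients.\<close>

theorem theorem3p4:
  fixes R :: "real ^ 'n \<Rightarrow> ereal"
    and F :: "real ^ 'n \<Rightarrow> real"
    and gradF :: "real ^ 'n \<Rightarrow> real ^ 'n"
    and \<beta> :: real
    and a b \<gamma> :: "nat \<Rightarrow> real"
    and x ya yb :: "nat \<Rightarrow> real ^ 'n"
    and xstar :: "real ^ 'n"
    and M :: "(real ^ 'n) set"
  assumes R: "proper R" "convex_fun R" "lower_semicont R"
    and F_convex: "convex_on UNIV F"
    and F_grad: "\<And>z. GDERIV F z :> gradF z"
    and beta_pos: "\<beta> > 0"
    and F_lipschitz: "(1 / \<beta>)-lipschitz_on UNIV gradF"
    and Argmin_nonempty: "Argmin (\<lambda>z. ereal (F z) + R z) \<noteq> {}"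
    and FB: "FB_type_iterates gradF R \<beta> a b \<gamma> x ya yb"
    and lim: "x \<longlonglongrightarrow> xstar"
    and xstar: "xstar \<in> Argmin (\<lambda>z. ereal (F z) + R z)"
    and psmooth: "partly_smooth R xstar M"
    and F_C2: "\<exists>U. open U \<and> xstar \<in> U \<and> C2_on U F"
    and nondegenerate: "- gradF xstar \<in> rel_interior (subdifferential R xstar)"
  shows "\<exists>K>0. (\<forall>k\<ge>K. x k \<in> M) \<and>
     (affine M \<longrightarrow>
        M = (+) xstar ` T_space R xstar \<and>
        (\<forall>k>K. ya k \<in> M \<and> yb k \<in> M)) \<and>
     (locally_polyhedral R xstar \<longrightarrow>
        coincide_around xstar M ((+) xstar ` T_space R xstar) \<and>
        (\<forall>k>K. ya k \<in> M \<inter> (+) xstar ` T_space R xstar \<and>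
                yb k \<in> M \<inter> (+) xstar ` T_space R xstar) \<and>
        (\<exists>g. has_riemannian_gradient R M xstar g \<and>
             (\<forall>k\<ge>K. has_riemannian_gradient R M (x k) g)) \<and>
        (\<forall>k\<ge>K. has_riemannian_hessian R M (x k) (\<lambda>h. 0)))"
proof -
  let ?T = "T_space R xstar" and ?u = "- gradF xstar"
  let ?A = "(+) xstar ` T_space R xstar"
  have uR: "?u \<in> subdifferential R xstar" using nondegenerate rel_interior_subset by blast
  obtain r where r: "R xstar = ereal r" using subdifferential_finite[OF R(1) uR] .
  have "isCont gradF xstar"
    using lipschitz_on_continuous_on[OF F_lipschitz] by (simp add: continuous_on_eq_continuous_at)
  note iter = FB_type_subgradients[OF R(1,2) FB lim this]
  obtain w where w: "\<And>k. w k \<in> subdifferential R (x (Suc k))" "w \<longlonglongrightarrow> ?u"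
    using iter(3) by blast
  have "\<forall>\<^sub>F k in sequentially. x (Suc k) \<in> M"
    by (rule identification[OF R(1) psmooth nondegenerate LIMSEQ_Suc[OF lim] w])
  then have ev_M: "\<forall>\<^sub>F k in sequentially. x k \<in> M"
    using eventually_sequentially_Suc[of "\<lambda>k. x k \<in> M"] by simp
  have aff: "affine ?A"
    by (simp add: affine_translation[symmetric] subspace_imp_affine subspace_T_space)
  have ya: "ya k = x k + a k *\<^sub>R (x k - x (k - 1))" and yb: "yb k = x k + b k *\<^sub>R (x k - x (k - 1))" for k
    using FB unfolding FB_type_iterates_def by blast+
  have C2: "C2_submanifold_around M xstar" "C2_along_around R M xstar" "xstar \<in> M"
    using psmooth by (auto simp: partly_smooth_def)
  obtain U1 where U1: "open U1" "xstar \<in> U1" "\<And>z. z \<in> M \<inter> U1 \<Longrightarrow> C2_submanifold_around M z"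
    using C2_submanifold_around_nearby[OF C2(1)] by blast
  obtain U2 where U2: "open U2" "xstar \<in> U2" "\<And>z. z \<in> U2 \<Longrightarrow> C2_along_around R M z"
    using C2_along_around_nearby[OF C2(2)] by blast
  \<comment> \<open>The neighbourhood is fixed before the case is known, so that one
    \<open>K\<close> serves both implications.\<close>
  obtain W0 where W0: "open W0" "xstar \<in> W0"
    and lpW0: "locally_polyhedral R xstar \<Longrightarrow> M \<inter> W0 = ?A \<inter> W0 \<and>
      (\<forall>y \<in> M \<inter> W0. R y = ereal (r + ?u \<bullet> (y - xstar)))"
  proof (cases "locally_polyhedral R xstar")
    case True
    show thesis
      by (rule locally_polyhedral_partly_smooth[OF R(1,2) psmooth True nondegenerate r])
         (rule that, blast+)
  next
    case False
    then show thesis using that[of UNIV] by blast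
  qed
  define W where "W = W0 \<inter> U1 \<inter> U2"
  have W: "open W" "xstar \<in> W" using W0 U1 U2 by (auto simp: W_def)
  have "\<forall>\<^sub>F k in sequentially. x k \<in> W" "\<forall>\<^sub>F k in sequentially. ya k \<in> W"
    "\<forall>\<^sub>F k in sequentially. yb k \<in> W"
    using lim iter(1,2) W by (auto intro: topological_tendstoD)
  with ev_M have "\<forall>\<^sub>F k in sequentially. x k \<in> M \<and> x k \<in> W \<and> ya k \<in> W \<and> yb k \<in> W"
    by eventually_elim blast
  then obtain N where N: "\<And>k. k \<ge> N \<Longrightarrow> x k \<in> M \<and> x k \<in> W \<and> ya k \<in> W \<and> yb k \<in> W"
    unfolding eventually_sequentially by blast
  define K where "K = Suc N"
  have K: "x k \<in> M" "x k \<in> W" "ya k \<in> W" "yb k \<in> W" if "k \<ge> K" for k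
    using N[of k] that by (auto simp: K_def)
  \<comment> \<open>Strictness of \<open>k > K\<close> puts \<open>x (k - 1)\<close> in
    \<open>?A\<close> as well; the inertial points are affine combinations of it and
    \<open>x k\<close>.\<close>
  have yA: "ya k \<in> ?A" "yb k \<in> ?A" if A: "\<And>k. k \<ge> K \<Longrightarrow> x k \<in> ?A" and k: "k > K" for k
    using k mem_affine_3_minus[OF aff A A A, of k k "k - 1"] by (simp_all add: ya yb)
  have affine_case: "M = ?A \<and> (\<forall>k>K. ya k \<in> M \<and> yb k \<in> M)" if "affine M"
    using partly_smooth_affine[OF psmooth that] yA K(1) by metis
  have polyhedral_case: "coincide_around xstar M ?A \<and>
      (\<forall>k>K. ya k \<in> M \<inter> ?A \<and> yb k \<in> M \<inter> ?A) \<and>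
      (\<exists>g. has_riemannian_gradient R M xstar g \<and>
           (\<forall>k\<ge>K. has_riemannian_gradient R M (x k) g)) \<and>
      (\<forall>k\<ge>K. has_riemannian_hessian R M (x k) (\<lambda>h. 0))" if lp: "locally_polyhedral R xstar"
  proof -
    have MW: "M \<inter> W = ?A \<inter> W" using lpW0[OF lp] by (auto simp: W_def)
    have val: "R y = ereal (r + ?u \<bullet> (y - xstar))" if "y \<in> M \<inter> W" for y
      using lpW0[OF lp] that by (auto simp: W_def)
    have C2W: "C2_submanifold_around M y \<and> C2_along_around R M y" if "y \<in> M \<inter> W" for y
      using U1(3) U2(3) that by (auto simp: W_def)
    \<comment> \<open>The gradient is the tangential component of \<open>?u\<close>; tangent vectors
      do not see the normal one.\<close>
    obtain g n where g: "g \<in> span ?T" and n: "\<And>h. h \<in> span ?T \<Longrightarrow> orthogonal n h"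
      and gn: "?u = g + n"
      using orthogonal_subspace_decomp_exists[of ?T ?u] by metis
    have gT: "g \<in> ?T" using g subspace_T_space span_eq_iff by blast
    have gu: "g \<bullet> h = ?u \<bullet> h" if "h \<in> ?T" for h
      using n[OF span_base[OF that]] unfolding gn by (simp add: inner_add_left orthogonal_def)
    note flat = subspace_T_space W(1) MW val C2W gT gu
    have xk: "x k \<in> M \<inter> W" if "k \<ge> K" for k using K that by blast
    have "coincide_around xstar M ?A" unfolding coincide_around_def using W MW by blast
    \<comment> \<open>Membership in \<open>?A\<close> passes to \<open>M\<close> only inside
      \<open>W\<close>, hence the choice of \<open>K\<close> with \<open>ya k\<close> and
      \<open>yb k\<close> in \<open>W\<close>.\<close>
    moreover have "ya k \<in> M \<inter> ?A \<and> yb k \<in> M \<inter> ?A" if "k > K" for k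
      using yA[OF _ that] xk K(3,4)[of k] MW that by auto
    moreover have "has_riemannian_gradient R M z g" if "z \<in> M \<inter> W" for z
      by (rule has_riemannian_gradient_flat[OF flat that])
    moreover have "has_riemannian_hessian R M z (\<lambda>h. 0)" if "z \<in> M \<inter> W" for z
      by (rule has_riemannian_hessian_flat[OF flat that])
    ultimately show ?thesis using xk W(2) C2(3) by blast
  qed
  have "K > 0" by (simp add: K_def)
  then show ?thesis
    using K(1) affine_case polyhedral_case by (intro exI[of _ K] conjI allI impI) blast+
qed

end
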